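(* Let $\mathcal{B}$ be a building set on a finite set $X$ such that the extended nestohedron $\mathcal{P}^{\square}(\mathcal{B})$ is a flag simple polytope. Then every entry of the $\gamma$-vector of $\mathcal{P}^{\square}(\mathcal{B})$ is nonnegative.
   Context: A building set on $X$ is a collection $\mathcal{B}$ of nonempty subsets of $X$ containing all singletons and such that $I\cup J\in\mathcal{B}$ whenever $I,J\in\mathcal{B}$, $I\cap J\neq\varnothing$. An extended nested collection is a set $\{I_1,\dots,I_m,x_{i_1},\dots,x_{i_r}\}$ with $I_j\in\mathcal{B}$ and formal symbols $x_i$ ($i\in X$) such that the $I_j$ are pairwise nested or disjoint, no union of $k\ge2$ pairwise disjoint $I_j$'s lies in $\mathcal{B}$, and no $i_\ell$ lies in any $I_j$. The extended nested complex $\mathcal{N}^{\square}(\mathcal{B})$ is the simplicial complex on vertex set $\mathcal{B}\cup\{x_i:i\in X\}$ whose faces are the extended nested collections; it is the boundary complex of a simplicial polytope of dimension $d=|X|$, and the extended nestohedron $\mathcal{P}^{\square}(\mathcal{B})$ is its polar dual simple polytope, so its number $f_i$ of $i$-faces equals the number of extended nested collections of cardinality $d-i$. $\mathcal{P}^{\square}(\mathcal{B})$ is flag if $\mathcal{N}^{\square}(\mathcal{B})$ is a flag complex, i.e. every set of pairwise adjacent vertices is a face. With $f_P(t)=\sum_{i=0}^d f_it^i$, the $h$-polynomial is defined by $f_P(t)=h_P(t+1)$, and the $\gamma$-vector $(\gamma_0,\dots,\gamma_{\lfloor d/2\rfloor})$ by $h_P(t)=\sum_{i=0}^{\lfloor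 d/2\rfloor}\gamma_i t^i(1+t)^{d-2i}$. *)

theory Defs
  imports "HOL-Analysis.Analysis" "HOL-Computational_Algebra.Polynomial"
begin

definition building_set :: "'a set \<Rightarrow> 'a set set \<Rightarrow> bool" where
  "building_set X \<B> \<longleftrightarrow>
     (\<forall>I\<in>\<B>. I \<noteq> {} \<and> I \<subseteq> X) \<and>
     (\<forall>x\<in>X. {x} \<in> \<B>) \<and>
     (\<forall>I\<in>\<B>. \<forall>J\<in>\<B>. I \<inter> J \<noteq> {} \<longrightarrow> I \<union> J \<in> \<B>)"

(* Sym i is the formal symbol x_i; it is distinct from the vertex Block {i}. *)
datatype 'a ext_vertex = Block "'a set" | Sym 'a

definition ext_vertices :: "'a set \<Rightarrow> 'a set set \<Rightarrow> 'a ext_vertex set" where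
  "ext_vertices X \<B> = Block ` \<B> \<union> Sym ` X"

definition ext_nested :: "'a set \<Rightarrow> 'a set set \<Rightarrow> 'a ext_vertex set \<Rightarrow> bool" where
  "ext_nested X \<B> C \<longleftrightarrow>
     C \<subseteq> ext_vertices X \<B> \<and>
     (\<forall>I J. Block I \<in> C \<longrightarrow> Block J \<in> C \<longrightarrow> I \<subseteq> J \<or> J \<subseteq> I \<or> disjnt I J) \<and>
     (\<forall>S. S \<subseteq> {I. Block I \<in> C} \<longrightarrow> card S \<ge> 2 \<longrightarrow> pairwise disjnt S \<longrightarrow> \<Union>S \<notin> \<B>) \<and>
     (\<forall>i I. Sym i \<in> C \<longrightarrow> Block I \<in> C \<longrightarrow> i \<notin> I)"

(* The empty collection is a face. *)
definition ext_nested_complex :: "'a set \<Rightarrow> 'a set set \<Rightarrow> 'a ext_vertex set set" where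
  "ext_nested_complex X \<B> = {C. ext_nested X \<B> C}"

definition flag_complex :: "'b set \<Rightarrow> 'b set set \<Rightarrow> bool" where
  "flag_complex V K \<longleftrightarrow>
     (\<forall>S. S \<subseteq> V \<longrightarrow> (\<forall>u\<in>S. \<forall>w\<in>S. u \<noteq> w \<longrightarrow> {u, w} \<in> K) \<longrightarrow> S \<in> K)"

definition simplicial_polytope :: "'v::euclidean_space set \<Rightarrow> bool" where
  "simplicial_polytope Q \<longleftrightarrow>
     polytope Q \<and> (\<forall>F. F face_of Q \<longrightarrow> F \<noteq> Q \<longrightarrow> (\<exists>n. n simplex F))"

definition simple_polytope :: "'v::euclidean_space set \<Rightarrow> bool" where
  "simple_polytope P \<longleftrightarrow>
     polytope P \<and>
     (\<forall>x. x extreme_point_of P \<longrightarrow> int (card {F. F facet_of P \<and> x \<in> F}) = aff_dim P)"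

(* The vertices of the complex K on V are placed at points of the space in such a way that
   the convex hulls of the faces of K are, without repetition, the proper faces of Q
   (including the empty one). *)
definition has_boundary_complex ::
    "'v::euclidean_space set \<Rightarrow> 'b set \<Rightarrow> 'b set set \<Rightarrow> bool" where
  "has_boundary_complex Q V K \<longleftrightarrow>
     (\<exists>v. inj_on v V \<and>
          bij_betw (\<lambda>C. convex hull (v ` C)) K {F. F face_of Q \<and> F \<noteq> Q})"

(* The dual is formed inside the linear span of Q, so that Q need not be full-dimensional in
   the ambient space; it is meant for Q having the origin in its relative interior. *)
definition polar_dual :: "'v::euclidean_space set \<Rightarrow> 'v set" where
  "polar_dual Q = {y \<in> span Q. \<forall>x\<in>Q. inner x y \<le> 1}"

(* The extended nestohedron is only determined up to the choice of the simplicial polytope Q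
   realizing the extended nested complex, hence a predicate on P. *)
definition extended_nestohedron ::
    "'a set \<Rightarrow> 'a set set \<Rightarrow> 'v::euclidean_space set \<Rightarrow> bool" where
  "extended_nestohedron X \<B> P \<longleftrightarrow>
     (\<exists>Q. simplicial_polytope Q \<and> aff_dim Q = int (card X) \<and> 0 \<in> rel_interior Q \<and>
          has_boundary_complex Q (ext_vertices X \<B>) (ext_nested_complex X \<B>) \<and>
          P = polar_dual Q)"

definition poly_dim :: "'v::euclidean_space set \<Rightarrow> nat" where
  "poly_dim P = nat (aff_dim P)"

definition num_faces :: "'v::euclidean_space set \<Rightarrow> nat \<Rightarrow> nat" where
  "num_faces P i = card {F. F face_of P \<and> aff_dim F = int i}"

definition f_poly :: "'v::euclidean_space set \<Rightarrow> int poly" where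
  "f_poly P = (\<Sum>i\<le>poly_dim P. monom (int (num_faces P i)) i)"

definition h_poly :: "'v::euclidean_space set \<Rightarrow> int poly" where
  "h_poly P = pcompose (f_poly P) [:-1, 1:]"

lemma f_poly_eq_h_poly: "f_poly P = pcompose (h_poly P) [:1, 1:]"
  by (simp add: h_poly_def pcompose_assoc [symmetric] pcompose_pCons)

definition gamma_expansion :: "nat \<Rightarrow> int list \<Rightarrow> int poly" where
  "gamma_expansion d g =
     (\<Sum>i\<le>d div 2. smult (g ! i) ([:0, 1:] ^ i * [:1, 1:] ^ (d - 2 * i)))"

definition is_gamma_vector :: "'v::euclidean_space set \<Rightarrow> int list \<Rightarrow> bool" where
  "is_gamma_vector P g \<longleftrightarrow>
     length g = poly_dim P div 2 + 1 \<and> h_poly P = gamma_expansion (poly_dim P) g"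

definition gamma_vector :: "'v::euclidean_space set \<Rightarrow> int list" where
  "gamma_vector P = (THE g. is_gamma_vector P g)"

lemma gamma_expansion_inj:
  assumes "length g = d div 2 + 1" "length g' = d div 2 + 1"
    and eq: "gamma_expansion d g = gamma_expansion d g'"
  shows "g = g'"
proof -
  have co: "coeff ([:0, 1:] ^ i * [:1, 1:] ^ n :: int poly) k =
      (if k < i then 0 else coeff ([:1, 1:] ^ n) (k - i))" for i n k
    by (simp add: monom_altdef [where c = "1::int", simplified, symmetric] coeff_monom_mult)
  have c0: "coeff ([:1, 1:] ^ n :: int poly) 0 = 1" for n
    by (simp add: coeff_0_power)
  have "g ! k = g' ! k" if "k \<le> d div 2" for k
    using that
  proof (induction k rule: less_induct)
    case (less k)
    let ?t = "\<lambda>i. coeff ([:0, 1:] ^ i * [:1, 1:] ^ (d - 2 * i) :: int poly) k"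
    have "(\<Sum>i\<le>d div 2. (g ! i - g' ! i) * ?t i) = 0"
      using arg_cong [OF eq, of "\<lambda>p. coeff p k"]
      by (simp add: gamma_expansion_def coeff_sum left_diff_distrib sum_subtractf)
    moreover have "(g ! i - g' ! i) * ?t i = (if i = k then g ! k - g' ! k else 0)"
      if "i \<le> d div 2" for i
      using less.IH [of i] that by (cases i k rule: linorder_cases) (simp_all add: co c0)
    ultimately have "(\<Sum>i\<le>d div 2. if i = k then g ! k - g' ! k else 0) = 0"
      by simp
    then show ?case
      using less.prems by simp
  qed
  then show ?thesis
    using assms by (intro nth_equalityI) auto
qed

lemma gamma_vector_eqI: "is_gamma_vector P g \<Longrightarrow> gamma_vector P = g"
  unfolding gamma_vector_def by (auto simp: is_gamma_vector_def intro!: the_equality gamma_expansion_inj)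

end

theory Submission
  imports Defs
begin

text \<open>
  Flagness forces every non-singleton member of \<open>\<B>\<close> to be a disjoint union of two members of
  \<open>\<B>\<close>. Hence \<open>\<B>\<close> can be built from the singletons by adding one set at a time, where each new set
  is a disjoint union \<open>I1 \<union> I2\<close> of two sets already present and every stage is a building set. Such
  a step replaces the extended nested complex by its stellar subdivision at the edge
  \<open>{I1, I2}\<close>, and the singletons give the boundary of a cross-polytope. Subdividing an edge \<open>{a, b}\<close>
  adds \<open>t\<close> times the \<open>h\<close>-polynomial of the link of the edge to the \<open>h\<close>-polynomial; the links of
  the new complex are links of the old one, subdivisions of such, or suspensions of such, so
  \<open>\<gamma>\<close>-nonnegativity of all links at once is preserved. Polarity turns the face numbers of the
  nestohedron into those of the complex.
\<close>

section \<open>Edge subdivisions and \<open>\<gamma>\<close>-nonnegativity\<close>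

text \<open>All links are treated at once because the term added by a subdivision comes from the
  link of an edge, about which the \<gamma>-vector of the whole complex says nothing. Membership in
  \<open>gamma_nonneg n\<close> bundles the existence of a \<gamma>-expansion (hence palindromicity)
  with the signs, so both travel through the induction together. The order of adding sets is the
  delicate point: the union of a new set with any set that meets it and is not contained in it must
  already be present. Two extremal choices settle this. A missing set of least size shows that some
  missing set splits into two present ones; among all missing sets that split in this way, one of
  greatest size is added. On the polytope side only some \<open>Q\<close> realizing the complex is
  given. The bijection between faces carries no dimensions, so these are recovered from the
  simplices and then transported by polarity.\<close>

definition gamma_nonneg :: "nat \<Rightarrow> int poly set" where
  "gamma_nonneg n = {p. \<exists>g. (\<forall>i. 0 \<le> g i) \<and>
     p = (\<Sum>i\<le>n div 2. smult (g i) ([:0, 1:] ^ i * [:1, 1:] ^ (n - 2 * i)))}"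

lemma gamma_nonneg_add:
  assumes "p \<in> gamma_nonneg n" "q \<in> gamma_nonneg n"
  shows "p + q \<in> gamma_nonneg n"
proof -
  obtain g h where "\<forall>i. 0 \<le> g i" "\<forall>i. 0 \<le> h i"
    and "p = (\<Sum>i\<le>n div 2. smult (g i) ([:0, 1:] ^ i * [:1, 1:] ^ (n - 2 * i)))"
    and "q = (\<Sum>i\<le>n div 2. smult (h i) ([:0, 1:] ^ i * [:1, 1:] ^ (n - 2 * i)))"
    using assms unfolding gamma_nonneg_def by blast
  then show ?thesis
    unfolding gamma_nonneg_def
    by (intro CollectI exI [of _ "\<lambda>i. g i + h i"]) (simp add: smult_add_left sum.distrib)
qed

lemma gamma_nonneg_power: "[:1, 1:] ^ n \<in> gamma_nonneg n"
proof -
  have "(\<Sum>i\<le>n div 2. smult (if i = 0 then 1 else 0) ([:0, 1:] ^ i * [:1, 1:] ^ (n - 2 * i)))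
      = (\<Sum>i\<le>n div 2. if i = 0 then [:1, 1:] ^ n else (0 :: int poly))"
    by (intro sum.cong) auto
  also have "\<dots> = [:1, 1:] ^ n" by simp
  finally show ?thesis
    unfolding gamma_nonneg_def
    by (intro CollectI exI [of _ "\<lambda>i. if i = 0 then 1 else 0"]) simp
qed

lemma gamma_nonneg_mult_1_plus_X:
  assumes "p \<in> gamma_nonneg n"
  shows "[:1, 1:] * p \<in> gamma_nonneg (Suc n)"
proof -
  obtain g where g: "\<forall>i. 0 \<le> g i"
    and p: "p = (\<Sum>i\<le>n div 2. smult (g i) ([:0, 1:] ^ i * [:1, 1:] ^ (n - 2 * i)))"
    using assms unfolding gamma_nonneg_def by blast
  \<comment> \<open>For odd \<open>n\<close> the range up to \<open>Suc n div 2\<close> has one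
    index more than before; its coefficient must be 0.\<close>
  define g' where "g' i = (if i \<le> n div 2 then g i else 0)" for i
  have "[:1, 1:] * p = (\<Sum>i\<le>n div 2. smult (g' i) ([:0, 1:] ^ i * [:1, 1:] ^ (Suc n - 2 * i)))"
    unfolding p sum_distrib_left
  proof (intro sum.cong refl)
    fix i assume "i \<in> {..n div 2}"
    then have "Suc n - 2 * i = Suc (n - 2 * i)" "g' i = g i" by (auto simp: g'_def)
    then show "[:1, 1:] * smult (g i) ([:0, 1:] ^ i * [:1, 1:] ^ (n - 2 * i)) =
      smult (g' i) ([:0, 1:] ^ i * [:1, 1:] ^ (Suc n - 2 * i))"
      by (simp only: power_Suc mult_smult_right) (simp only: mult_ac)
  qed
  also have "\<dots> = (\<Sum>i\<le>Suc n div 2. smult (g' i) ([:0, 1:] ^ i * [:1, 1:] ^ (Suc n - 2 * i)))"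
    by (intro sum.mono_neutral_left) (auto simp: g'_def)
  finally show ?thesis
    using g unfolding gamma_nonneg_def by (intro CollectI exI [of _ g']) (simp add: g'_def)
qed

text \<open>Multiplication by t moves the \<gamma>-vector up by one place, since (n + 2) - 2(i + 1)
  = n - 2i.\<close>

lemma gamma_nonneg_mult_X:
  assumes "p \<in> gamma_nonneg n"
  shows "[:0, 1:] * p \<in> gamma_nonneg (Suc (Suc n))"
proof -
  obtain g where g: "\<forall>i. 0 \<le> g i"
    and p: "p = (\<Sum>i\<le>n div 2. smult (g i) ([:0, 1:] ^ i * [:1, 1:] ^ (n - 2 * i)))"
    using assms unfolding gamma_nonneg_def by blast
  define g' where "g' i = (case i of 0 \<Rightarrow> 0 | Suc j \<Rightarrow> g j)" for i
  have "(\<Sum>i\<le>Suc (Suc n) div 2. smult (g' i) ([:0, 1:] ^ i * [:1, 1:] ^ (Suc (Suc n) - 2 * i)))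
     = (\<Sum>i\<le>n div 2. smult (g i) ([:0, 1:] ^ Suc i * [:1, 1:] ^ (n - 2 * i)))"
    unfolding div2_Suc_Suc sum.atMost_Suc_shift by (simp add: g'_def)
  also have "\<dots> = [:0, 1:] * p"
    unfolding p sum_distrib_left
    by (intro sum.cong refl) (simp only: power_Suc mult_smult_right mult_ac)
  finally show ?thesis
    using g unfolding gamma_nonneg_def
    by (intro CollectI exI [of _ g']) (simp add: g'_def split: nat.split)
qed

text \<open>
  Up to the shift from \<open>d\<close> to \<open>d - card C\<close>, this is the \<open>h\<close>-polynomial of the link of \<open>C\<close>: the
  faces \<open>E\<close> containing \<open>C\<close> stand for the faces \<open>E - C\<close> of the link.
\<close>

definition star_poly :: "nat \<Rightarrow> 'b set set \<Rightarrow> 'b set \<Rightarrow> int poly" where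
  "star_poly d K C = (\<Sum>E | E \<in> K \<and> C \<subseteq> E. [:-1, 1:] ^ (d - card E))"

text \<open>The bound on \<open>card C\<close> guards the truncated subtraction in
  \<open>star_poly\<close>: every shift of an exponent below relies on it.\<close>

definition gamma_nonneg_links :: "nat \<Rightarrow> 'b set set \<Rightarrow> bool" where
  "gamma_nonneg_links d K \<longleftrightarrow>
     (\<forall>C\<in>K. card C \<le> d \<and> star_poly d K C \<in> gamma_nonneg (d - card C))"

text \<open>The stellar subdivision at the edge {a, b} with new vertex \<open>c\<close>. In the
  second part \<open>D\<close> runs over the join of the boundary of the edge with its link, so it
  may contain one of \<open>a\<close>, \<open>b\<close> but not both.\<close>

definition edge_subdivision :: "'b \<Rightarrow> 'b \<Rightarrow> 'b \<Rightarrow> 'b set set \<Rightarrow> 'b set set" where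
  "edge_subdivision a b c K = {D \<in> K. \<not> {a, b} \<subseteq> D} \<union>
     insert c ` {D. insert a (insert b D) \<in> K \<and> \<not> {a, b} \<subseteq> D}"

text \<open>Let s be the star polynomial of C together with {a, b}. For a face C without
  \<open>c\<close>, subdividing removes s and adds \<open>T C\<close>, which is (1 + t)s if C avoids
  both ends and s if it contains exactly one. The net change is t s or 0. For a face containing
  \<open>c\<close>, the star polynomial is \<open>T (C - {c})\<close> alone. In each case the degree
  shifts by the matching amount.\<close>

lemma gamma_nonneg_links_edge_subdivision:
  fixes K :: "'b set set"
  assumes fin: "finite K" "\<And>C. C \<in> K \<Longrightarrow> finite C"
    and down: "\<And>C D. C \<in> K \<Longrightarrow> D \<subseteq> C \<Longrightarrow> D \<in> K"
    and ab: "a \<noteq> b" and c: "\<And>C. C \<in> K \<Longrightarrow> c \<notin> C" "c \<noteq> a" "c \<noteq> b"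
    and K: "gamma_nonneg_links d K"
  shows "gamma_nonneg_links d (edge_subdivision a b c K)"
proof -
  let ?K' = "edge_subdivision a b c K"
  let ?y = "[:-1, 1:] :: int poly"
  let ?ab = "\<lambda>D. insert a (insert b D)"
  have card_d: "card C \<le> d" if "C \<in> K" for C
    using K that by (simp add: gamma_nonneg_links_def)
  \<comment> \<open>\<open>insert c ` N C\<close> are the faces of the subdivision that contain \<open>insert c C\<close>.\<close>
  define N where "N C = {D. ?ab D \<in> K \<and> \<not> {a, b} \<subseteq> D \<and> C \<subseteq> D}" for C
  define T where "T C = (\<Sum>D\<in>N C. ?y ^ (d - Suc (card D)))" for C
  have finN: "finite D" "c \<notin> D" "finite (?ab D)" if "D \<in> N C" for C D
    using that fin(2) [of "?ab D"] c(1) [of "?ab D"] by (auto simp: N_def)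
  have finiteN: "finite (N C)" for C
    by (rule finite_subset [of _ "Pow (\<Union>K)"]) (use fin in \<open>auto simp: N_def\<close>)
  \<comment> \<open>If \<open>D\<close> contains one end \<open>u\<close> of the edge, adding the
    other end \<open>v\<close> gives a face through the whole edge; \<open>v\<close> takes the place
    of the new vertex in the cardinality.\<close>
  have remove: "(\<Sum>D\<in>{D \<in> N C. u \<in> D}. ?y ^ (d - Suc (card D))) = star_poly d K (?ab C)"
    if uv: "{u, v} = {a, b}" and v: "v \<notin> C" for u v C
    unfolding star_poly_def
  proof (intro sum.reindex_bij_witness [of _ "\<lambda>M. M - {v}" "insert v"])
    fix D assume "D \<in> {D \<in> N C. u \<in> D}"
    then have D: "D \<in> N C" "u \<in> D" by auto
    then have "\<not> {u, v} \<subseteq> D" using uv by (simp add: N_def)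
    then have vD: "v \<notin> D" using D by auto
    have "?ab D = {a, b} \<union> D" by auto
    also have "\<dots> = insert v D" unfolding uv [symmetric] using D by auto
    finally have "?ab D = insert v D" .
    then show "insert v D - {v} = D" "insert v D \<in> {E \<in> K. ?ab C \<subseteq> E}"
      "?y ^ (d - card (insert v D)) = ?y ^ (d - Suc (card D))"
      using vD D finN [OF D(1)] by (auto simp: N_def)
  next
    fix M assume M: "M \<in> {E \<in> K. ?ab C \<subseteq> E}"
    then have "{a, b} \<subseteq> M" by auto
    then have uvM: "u \<in> M" "v \<in> M" using uv by auto
    have "u \<noteq> v" using uv ab by auto
    have "?ab (M - {v}) = {a, b} \<union> (M - {v})" by auto
    also have "\<dots> = M" unfolding uv [symmetric] using uvM by auto
    finally have "?ab (M - {v}) = M" .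
    moreover have "\<not> {a, b} \<subseteq> M - {v}" unfolding uv [symmetric] by simp
    ultimately show "M - {v} \<in> {D \<in> N C. u \<in> D}" "insert v (M - {v}) = M"
      using M v uvM \<open>u \<noteq> v\<close> by (auto simp: N_def)
  qed
  \<comment> \<open>Split by the ends that \<open>D\<close> contains: only a, only b, or neither.
    The first two parts give s each; in the third, adding the edge raises the cardinality by 2 where
    adding \<open>c\<close> raises it by 1, hence the factor t - 1. Together s + s + (t - 1)s = (1 +
    t)s. If \<open>C\<close> itself contains one end, only one of the first two parts
    survives.\<close>
  have T: "T C = (if {a, b} \<subseteq> C then 0 else
      if C \<inter> {a, b} = {} then [:1, 1:] * star_poly d K (?ab C) else star_poly d K (?ab C))" for C
  proof -
    let ?S = "{M \<in> K. ?ab C \<subseteq> M}"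
    have split: "N C = {D \<in> N C. a \<in> D} \<union> ({D \<in> N C. b \<in> D} \<union> {D \<in> N C. a \<notin> D \<and> b \<notin> D})" by auto
    let ?w = "\<lambda>D. ?y ^ (d - Suc (card D))"
    have "T C = sum ?w {D \<in> N C. a \<in> D} + sum ?w ({D \<in> N C. b \<in> D} \<union> {D \<in> N C. a \<notin> D \<and> b \<notin> D})"
      unfolding T_def
      by (subst split, rule sum.union_disjoint) (simp_all add: finiteN, auto simp: N_def)
    also have "sum ?w ({D \<in> N C. b \<in> D} \<union> {D \<in> N C. a \<notin> D \<and> b \<notin> D})
        = sum ?w {D \<in> N C. b \<in> D} + sum ?w {D \<in> N C. a \<notin> D \<and> b \<notin> D}"
      by (rule sum.union_disjoint) (simp_all add: finiteN, auto)
    finally have "T C = sum ?w {D \<in> N C. a \<in> D} +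
      (sum ?w {D \<in> N C. b \<in> D} + sum ?w {D \<in> N C. a \<notin> D \<and> b \<notin> D})" .
    moreover have "(\<Sum>D\<in>{D \<in> N C. a \<in> D}. ?y ^ (d - Suc (card D))) =
        (if b \<in> C then 0 else star_poly d K (?ab C))"
    proof (cases "b \<in> C")
      case True
      then have "{D \<in> N C. a \<in> D} = {}" by (auto simp: N_def)
      then show ?thesis using True by (simp only: if_True sum.empty)
    next
      case False
      then show ?thesis using remove [of a b C] by simp
    qed
    moreover have "(\<Sum>D\<in>{D \<in> N C. b \<in> D}. ?y ^ (d - Suc (card D))) =
        (if a \<in> C then 0 else star_poly d K (?ab C))"
    proof (cases "a \<in> C")
      case True
      then have "{D \<in> N C. b \<in> D} = {}" by (auto simp: N_def)
      then show ?thesis using True by (simp only: if_True sum.empty)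
    next
      case False
      then show ?thesis using remove [of b a C] by (simp add: insert_commute)
    qed
    moreover have "(\<Sum>D\<in>{D \<in> N C. a \<notin> D \<and> b \<notin> D}. ?y ^ (d - Suc (card D))) =
        (if C \<inter> {a, b} \<noteq> {} then 0 else ?y * star_poly d K (?ab C))"
    proof (cases "C \<inter> {a, b} = {}")
      case False
      then have "{D \<in> N C. a \<notin> D \<and> b \<notin> D} = {}" by (auto simp: N_def)
      then show ?thesis using False by (simp only: if_True not_False_eq_True sum.empty)
    next
      case True
      have "(\<Sum>D\<in>{D \<in> N C. a \<notin> D \<and> b \<notin> D}. ?y ^ (d - Suc (card D))) =
         (\<Sum>M\<in>?S. ?y * ?y ^ (d - card M))"
      proof (intro sum.reindex_bij_witness [of _ "\<lambda>M. M - {a, b}" ?ab])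
        fix D assume D: "D \<in> {D \<in> N C. a \<notin> D \<and> b \<notin> D}"
        then have "card (?ab D) = Suc (Suc (card D))" using ab finN [of D C] by simp
        moreover have "card (?ab D) \<le> d" using D by (intro card_d) (simp add: N_def)
        ultimately have "d - Suc (card D) = Suc (d - card (?ab D))" by simp
        then show "?y * ?y ^ (d - card (?ab D)) = ?y ^ (d - Suc (card D))" by (simp only: power_Suc)
      next
        fix M assume "M \<in> ?S"
        then have "M \<in> K" "?ab C \<subseteq> M" by auto
        then show abM: "?ab (M - {a, b}) = M" by auto
        have "C \<subseteq> M - {a, b}" using True \<open>?ab C \<subseteq> M\<close> by auto
        then show "M - {a, b} \<in> {D \<in> N C. a \<notin> D \<and> b \<notin> D}"
          using \<open>M \<in> K\<close> by (simp add: N_def abM)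
      qed (auto simp: N_def)
      then show ?thesis using True by (simp add: star_poly_def sum_distrib_left)
    qed
    moreover have "p + (p + ?y * p) = [:1, 1:] * p" for p :: "int poly"
    proof -
      have "p + (p + ?y * p) = ([:1:] + ([:1:] + ?y)) * p" by (simp only: distrib_right) simp
      then show ?thesis by simp
    qed
    ultimately show ?thesis by auto
  qed
  have star_c: "star_poly d ?K' C = T (C - {c})" if "c \<in> C" for C
    unfolding T_def star_poly_def
  proof (intro sum.reindex_bij_witness [of _ "insert c" "\<lambda>E. E - {c}"])
    fix E assume E: "E \<in> {E \<in> ?K'. C \<subseteq> E}"
    then have "c \<in> E" using that by auto
    then obtain D where D: "?ab D \<in> K" "\<not> {a, b} \<subseteq> D" "E = insert c D"
      using E c(1) by (auto simp: edge_subdivision_def)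
    then have "c \<notin> D" "finite D" using c(1) [of "?ab D"] fin(2) [of "?ab D"] by auto
    then have "E - {c} = D" "card E = Suc (card D)" using D by auto
    then show "E - {c} \<in> N (C - {c})" "insert c (E - {c}) = E"
      "?y ^ (d - Suc (card (E - {c}))) = ?y ^ (d - card E)"
      using D E that by (auto simp: N_def)
  qed (use finN that in \<open>auto simp: N_def edge_subdivision_def\<close>)
  have star: "star_poly d ?K' C = star_poly d K C - star_poly d K (?ab C) + T C"
    if "c \<notin> C" for C
  proof -
    let ?w = "\<lambda>E. ?y ^ (d - card E)"
    have "{E \<in> ?K'. C \<subseteq> E} = {E \<in> K. C \<subseteq> E \<and> \<not> {a, b} \<subseteq> E} \<union> insert c ` N C"
      using that by (auto simp: edge_subdivision_def N_def)
    moreover have "{E \<in> K. C \<subseteq> E \<and> \<not> {a, b} \<subseteq> E} \<inter> insert c ` N C = {}" using c(1) by auto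
    ultimately have "star_poly d ?K' C =
        sum ?w {E \<in> K. C \<subseteq> E \<and> \<not> {a, b} \<subseteq> E} + sum ?w (insert c ` N C)"
      unfolding star_poly_def using fin(1) finiteN by (simp add: sum.union_disjoint)
    moreover have "sum ?w (insert c ` N C) = T C"
    proof -
      have "inj_on (insert c) (N C)" using finN(2) by (intro inj_onI) (metis insert_ident)
      then show ?thesis
        unfolding T_def by (simp add: sum.reindex finN)
    qed
    moreover have "star_poly d K C =
        sum ?w {E \<in> K. C \<subseteq> E \<and> \<not> {a, b} \<subseteq> E} + star_poly d K (?ab C)"
    proof -
      have "{E \<in> K. C \<subseteq> E} = {E \<in> K. C \<subseteq> E \<and> \<not> {a, b} \<subseteq> E} \<union> {E \<in> K. ?ab C \<subseteq> E}" by auto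
      then show ?thesis
        unfolding star_poly_def using fin(1)
        by (simp only:) (subst sum.union_disjoint, auto)
    qed
    ultimately show ?thesis by simp
  qed
  have nonneg: "star_poly d K C \<in> gamma_nonneg (d - card C)" if "C \<in> K" for C
    using K that by (simp add: gamma_nonneg_links_def)
  show ?thesis
    unfolding gamma_nonneg_links_def
  proof (intro ballI)
    fix C assume C: "C \<in> ?K'"
    show "card C \<le> d \<and> star_poly d ?K' C \<in> gamma_nonneg (d - card C)"
    proof (cases "c \<in> C")
      case False
      then have CK: "C \<in> K" and nab: "\<not> {a, b} \<subseteq> C"
        using C by (auto simp: edge_subdivision_def)
      show ?thesis
      proof (cases "C \<inter> {a, b} = {} \<and> ?ab C \<in> K")
        case True
        have "[:1, 1:] * p - p = [:0, 1:] * p" for p :: "int poly"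
          by (simp add: algebra_simps)
        then have "star_poly d ?K' C = star_poly d K C + [:0, 1:] * star_poly d K (?ab C)"
          using True nab by (simp only: star [OF False] T) (simp add: algebra_simps)
        moreover have "card (?ab C) = Suc (Suc (card C))"
          using True ab fin(2) [OF CK] by simp
        then have "d - card C = Suc (Suc (d - card (?ab C)))"
          using card_d [of "?ab C"] True by simp
        then have "[:0, 1:] * star_poly d K (?ab C) \<in> gamma_nonneg (d - card C)"
          using gamma_nonneg_mult_X [OF nonneg, of "?ab C"] True by simp
        ultimately show ?thesis
          using gamma_nonneg_add [OF nonneg [OF CK]] card_d [OF CK] by simp
      next
        case 2: False
        \<comment> \<open>Either \<open>C\<close> contains exactly one end, and what is added equals
          what is removed, or \<open>C\<close> and the edge span no face, and both vanish.\<close>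
        have "star_poly d ?K' C = star_poly d K C"
        proof (cases "?ab C \<in> K")
          case True
          then show ?thesis using 2 nab by (auto simp: star [OF False] T)
        next
          case False': False
          then have "{E \<in> K. ?ab C \<subseteq> E} = {}" using down by blast
          then have "star_poly d K (?ab C) = 0" by (simp only: star_poly_def sum.empty)
          then show ?thesis by (simp add: star [OF False] T)
        qed
        then show ?thesis using nonneg [OF CK] card_d [OF CK] by simp
      qed
    next
      case True
      then obtain D where D: "?ab D \<in> K" "\<not> {a, b} \<subseteq> D" "C = insert c D"
        using C c(1) by (auto simp: edge_subdivision_def)
      then have "c \<notin> D" "finite D" using c(1) [of "?ab D"] fin(2) [of "?ab D"] by auto
      then have CD: "C - {c} = D" "card C = Suc (card D)" using D by auto
      \<comment> \<open>If \<open>D\<close> avoids both ends, the link of \<open>C\<close> is the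
        suspension of the link of \<open>?ab D\<close>: a factor 1 + t and one degree more. If
        \<open>D\<close> contains one end, exchanging \<open>c\<close> for the missing end leaves
        cardinality and polynomial unchanged.\<close>
      show ?thesis
      proof (cases "D \<inter> {a, b} = {}")
        case True
        then have "card (?ab D) = Suc (card C)"
          using ab CD \<open>finite D\<close> by simp
        then have "d - card C = Suc (d - card (?ab D))" "card C \<le> d"
          using card_d [OF D(1)] by simp_all
        then show ?thesis
          using gamma_nonneg_mult_1_plus_X [OF nonneg [OF D(1)]] True D(2)
          by (simp only: star_c [OF \<open>c \<in> C\<close>] CD T) simp
      next
        case False
        then have "card (?ab D) = card C"
          using ab CD D(2) \<open>finite D\<close> by (auto simp: card_insert_if)
        then show ?thesis
          using nonneg [OF D(1)] card_d [OF D(1)] False D(2)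
          by (simp only: star_c [OF \<open>c \<in> C\<close>] CD T) simp
      qed
    qed
  qed
qed

section \<open>The boundary complex of the cross-polytope\<close>

text \<open>\<open>p i\<close> and \<open>q i\<close> are opposite vertices. Every link is again a
  cross-polytope boundary, and each direction that the face leaves free contributes a factor (t - 1)
  + 1 + 1 = 1 + t, according to whether a larger face uses neither vertex, \<open>p i\<close> or
  \<open>q i\<close>.\<close>

lemma gamma_nonneg_links_cross_polytope:
  fixes p q :: "'a \<Rightarrow> 'b"
  assumes X: "finite X" and inj: "inj_on p X" "inj_on q X" and pq: "p ` X \<inter> q ` X = {}"
  shows "gamma_nonneg_links (card X) {C. C \<subseteq> p ` X \<union> q ` X \<and> (\<forall>i\<in>X. \<not> {p i, q i} \<subseteq> C)}"
    (is "gamma_nonneg_links _ ?K")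
proof -
  let ?y = "[:-1, 1:] :: int poly"
  have finC: "finite C" if "C \<in> ?K" for C
    using that X finite_subset [of C "p ` X \<union> q ` X"] by auto
  \<comment> \<open>The codimension of a face counts its free directions, so a positive codimension
    in the induction below supplies one.\<close>
  have card_eq: "card {i \<in> X. p i \<notin> C \<and> q i \<notin> C} + card C = card X" if C: "C \<in> ?K" for C
  proof -
    have "C = p ` {i \<in> X. p i \<in> C} \<union> q ` {i \<in> X. q i \<in> C}" using C by auto
    then have "card C = card (p ` {i \<in> X. p i \<in> C} \<union> q ` {i \<in> X. q i \<in> C})" by simp
    also have "\<dots> = card (p ` {i \<in> X. p i \<in> C}) + card (q ` {i \<in> X. q i \<in> C})"
      using X pq by (intro card_Un_disjoint) auto
    also have "\<dots> = card {i \<in> X. p i \<in> C} + card {i \<in> X. q i \<in> C}"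
      using inj by (simp add: card_image inj_on_subset)
    also have "\<dots> = card ({i \<in> X. p i \<in> C} \<union> {i \<in> X. q i \<in> C})"
      using X C by (intro card_Un_disjoint [symmetric]) auto
    also have "card {i \<in> X. p i \<notin> C \<and> q i \<notin> C} + \<dots> =
        card ({i \<in> X. p i \<notin> C \<and> q i \<notin> C} \<union> ({i \<in> X. p i \<in> C} \<union> {i \<in> X. q i \<in> C}))"
      using X by (intro card_Un_disjoint [symmetric]) auto
    also have "{i \<in> X. p i \<notin> C \<and> q i \<notin> C} \<union> ({i \<in> X. p i \<in> C} \<union> {i \<in> X. q i \<in> C}) = X" by auto
    finally show ?thesis .
  qed
  have star: "star_poly (card X) ?K C = [:1, 1:] ^ n"
    if "C \<in> ?K" "n = card X - card C" for C n
    using that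
  proof (induction n arbitrary: C)
    case 0
    then have "card {i \<in> X. p i \<notin> C \<and> q i \<notin> C} = 0" using card_eq [of C] by linarith
    then have "{i \<in> X. p i \<notin> C \<and> q i \<notin> C} = {}" using X by simp
    then have "{E \<in> ?K. C \<subseteq> E} = {C}" using 0 by blast
    then show ?case using 0 by (simp add: star_poly_def)
  next
    case (Suc n)
    then have "card {i \<in> X. p i \<notin> C \<and> q i \<notin> C} \<noteq> 0" using card_eq [of C] by linarith
    then obtain i where i: "i \<in> X" "p i \<notin> C" "q i \<notin> C" by (auto simp: card_eq_0_iff)
    have pq': "p j \<noteq> q k" if "j \<in> X" "k \<in> X" for j k using pq that by auto
    have p_eq: "p j = p i \<longleftrightarrow> j = i" and q_eq: "q j = q i \<longleftrightarrow> j = i" if "j \<in> X" for j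
      using inj i that by (auto dest: inj_onD)
    have pC: "insert (p i) C \<in> ?K" and qC: "insert (q i) C \<in> ?K"
      using Suc.prems(1) i by (auto simp: pq' p_eq q_eq pq' [symmetric])
    let ?w = "\<lambda>E. ?y ^ (card X - card E)"
    have star_pC: "star_poly (card X) ?K (insert (p i) C) = [:1, 1:] ^ n"
      and star_qC: "star_poly (card X) ?K (insert (q i) C) = [:1, 1:] ^ n"
      using Suc.prems i pC qC finC [OF Suc.prems(1)] by (intro Suc.IH; simp)+
    have "{E \<in> ?K. C \<subseteq> E} = {E \<in> ?K. C \<subseteq> E \<and> p i \<notin> E \<and> q i \<notin> E} \<union>
        ({E \<in> ?K. insert (p i) C \<subseteq> E} \<union> {E \<in> ?K. insert (q i) C \<subseteq> E})" by auto
    moreover have "sum ?w \<dots> = sum ?w {E \<in> ?K. C \<subseteq> E \<and> p i \<notin> E \<and> q i \<notin> E} +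
        sum ?w ({E \<in> ?K. insert (p i) C \<subseteq> E} \<union> {E \<in> ?K. insert (q i) C \<subseteq> E})"
      using X by (intro sum.union_disjoint)
        (auto intro!: finite_subset [of _ "Pow (p ` X \<union> q ` X)"])
    moreover have "sum ?w ({E \<in> ?K. insert (p i) C \<subseteq> E} \<union> {E \<in> ?K. insert (q i) C \<subseteq> E}) =
        star_poly (card X) ?K (insert (p i) C) + star_poly (card X) ?K (insert (q i) C)"
      unfolding star_poly_def using X i
      by (intro sum.union_disjoint) (auto intro!: finite_subset [of _ "Pow (p ` X \<union> q ` X)"])
    \<comment> \<open>A face avoiding the free pair is one vertex smaller than its extension by
      \<open>p i\<close>, whence the factor t - 1.\<close>
    moreover have "sum ?w {E \<in> ?K. C \<subseteq> E \<and> p i \<notin> E \<and> q i \<notin> E} =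
        ?y * star_poly (card X) ?K (insert (p i) C)"
      unfolding star_poly_def sum_distrib_left
    proof (intro sum.reindex_bij_witness [of _ "\<lambda>E. E - {p i}" "insert (p i)"])
      fix E assume E: "E \<in> {E \<in> ?K. C \<subseteq> E \<and> p i \<notin> E \<and> q i \<notin> E}"
      then show *: "insert (p i) E \<in> {E \<in> ?K. insert (p i) C \<subseteq> E}"
        using i by (auto simp: pq' p_eq q_eq pq' [symmetric])
      have "card (insert (p i) E) = Suc (card E)" using E finC [of E] by simp
      moreover have "card (insert (p i) E) \<le> card X" using card_eq [of "insert (p i) E"] * by simp
      ultimately have "card X - card E = Suc (card X - card (insert (p i) E))" by simp
      then show "?y * ?y ^ (card X - card (insert (p i) E)) = ?y ^ (card X - card E)"
        by (simp only: power_Suc)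
    qed (use i in auto)
    ultimately have "star_poly (card X) ?K C = ?y * [:1, 1:] ^ n + ([:1, 1:] ^ n + [:1, 1:] ^ n)"
      unfolding star_pC star_qC by (simp only: star_poly_def)
    also have "\<dots> = (?y + ([:1:] + [:1:])) * [:1, 1:] ^ n"
      by (simp only: distrib_right) simp
    also have "?y + ([:1:] + [:1:]) = [:1, 1:]" by simp
    finally show ?case by simp
  qed
  show ?thesis
    unfolding gamma_nonneg_links_def
  proof (intro ballI conjI)
    fix C assume C: "C \<in> ?K"
    then show "card C \<le> card X" using card_eq [of C] by linarith
    show "star_poly (card X) ?K C \<in> gamma_nonneg (card X - card C)"
      unfolding star [OF C refl] by (rule gamma_nonneg_power)
  qed
qed

section \<open>Adding a set to a building set\<close>

lemma building_setD:
  assumes "building_set X \<B>"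
  shows "I \<in> \<B> \<Longrightarrow> I \<noteq> {}" "I \<in> \<B> \<Longrightarrow> I \<subseteq> X"
    and "I \<in> \<B> \<Longrightarrow> J \<in> \<B> \<Longrightarrow> I \<inter> J \<noteq> {} \<Longrightarrow> I \<union> J \<in> \<B>"
  using assms unfolding building_set_def by simp_all

lemma ext_nestedD:
  assumes "ext_nested X \<B> C"
  shows "C \<subseteq> ext_vertices X \<B>"
    and "Block I \<in> C \<Longrightarrow> Block J \<in> C \<Longrightarrow> I \<subseteq> J \<or> J \<subseteq> I \<or> disjnt I J"
    and "F \<subseteq> {I. Block I \<in> C} \<Longrightarrow> card F \<ge> 2 \<Longrightarrow> pairwise disjnt F \<Longrightarrow> \<Union>F \<notin> \<B>"
    and "Sym i \<in> C \<Longrightarrow> Block I \<in> C \<Longrightarrow> i \<notin> I"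
  using assms unfolding ext_nested_def by simp_all

lemma ext_nested_union_notin:
  assumes "ext_nested X \<B> C" "finite F" "\<And>I. I \<in> F \<Longrightarrow> Block I \<in> C" "pairwise disjnt F"
    and "I \<in> F" "J \<in> F" "I \<noteq> J"
  shows "\<Union>F \<notin> \<B>"
proof -
  have "card {I, J} \<le> card F" using assms by (intro card_mono) auto
  then have "card F \<ge> 2" using \<open>I \<noteq> J\<close> by simp
  moreover have "F \<subseteq> {I. Block I \<in> C}" using assms(3) by auto
  ultimately show ?thesis using ext_nestedD(3) [OF assms(1)] assms(4) by simp
qed

lemma ext_nested_subset:
  assumes "ext_nested X \<B> C" "D \<subseteq> C"
  shows "ext_nested X \<B> D"
proof -
  have "{I. Block I \<in> D} \<subseteq> {I. Block I \<in> C}" using assms by auto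
  from subset_trans [OF _ this] have "\<Union>F \<notin> \<B>"
    if "F \<subseteq> {I. Block I \<in> D}" "card F \<ge> 2" "pairwise disjnt F" for F
    using that ext_nestedD(3) [OF assms(1)] by blast
  then show ?thesis
    using assms(2) ext_nestedD(1,2,4) [OF assms(1)]
    unfolding ext_nested_def by (intro conjI allI impI) (simp_all add: subset_iff)
qed

lemma finite_ext_vertices: "finite X \<Longrightarrow> building_set X \<B> \<Longrightarrow> finite (ext_vertices X \<B>)"
  unfolding ext_vertices_def
  by (intro finite_UnI finite_imageI finite_subset [of \<B> "Pow X"]) (auto dest: building_setD(2))

lemma finite_ext_nested_complex:
  "finite X \<Longrightarrow> building_set X \<B> \<Longrightarrow> finite (ext_nested_complex X \<B>)"
  by (rule finite_subset [of _ "Pow (ext_vertices X \<B>)"])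
     (auto simp: ext_nested_complex_def finite_ext_vertices dest: ext_nestedD(1))

text \<open>The last assumption makes the two blocks an edge of the old complex: they are disjoint
  and their union is not a block.\<close>

locale building_set_step =
  fixes X :: "'a set" and \<B> :: "'a set set" and I1 I2 :: "'a set"
  assumes B: "building_set X \<B>" and B': "building_set X (insert (I1 \<union> I2) \<B>)"
    and I: "I1 \<in> \<B>" "I2 \<in> \<B>" "I1 \<inter> I2 = {}" and S: "I1 \<union> I2 \<notin> \<B>"
begin

lemma nonempty: "J \<in> \<B> \<Longrightarrow> J \<noteq> {}" "I1 \<noteq> {}" "I2 \<noteq> {}"
  using building_setD(1) [OF B] I by simp_all

lemma union: "J \<in> \<B> \<Longrightarrow> K \<in> \<B> \<Longrightarrow> J \<inter> K \<noteq> {} \<Longrightarrow> J \<union> K \<in> \<B>"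
  using building_setD(3) [OF B] .

lemma union': "J \<in> \<B> \<Longrightarrow> J \<inter> (I1 \<union> I2) \<noteq> {} \<Longrightarrow> \<not> J \<subseteq> I1 \<union> I2 \<Longrightarrow> J \<union> (I1 \<union> I2) \<in> \<B>"
proof -
  assume J: "J \<in> \<B>" "J \<inter> (I1 \<union> I2) \<noteq> {}" and *: "\<not> J \<subseteq> I1 \<union> I2"
  then have "J \<union> (I1 \<union> I2) \<in> insert (I1 \<union> I2) \<B>" using B' by (simp add: building_set_def)
  moreover have "J \<union> (I1 \<union> I2) \<noteq> I1 \<union> I2" using * by blast
  ultimately show ?thesis by simp
qed

text \<open>A block inside the new set that meets both halves would absorb them one after the other,
  putting \<open>I1 \<union> I2\<close> into \<B>.\<close>

lemma component: "J \<in> \<B> \<Longrightarrow> J \<subseteq> I1 \<union> I2 \<Longrightarrow> J \<subseteq> I1 \<and> J \<inter> I2 = {} \<or> J \<subseteq> I2 \<and> J \<inter> I1 = {}"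
proof (rule ccontr)
  assume J: "J \<in> \<B>" "J \<subseteq> I1 \<union> I2" and "\<not> (J \<subseteq> I1 \<and> J \<inter> I2 = {} \<or> J \<subseteq> I2 \<and> J \<inter> I1 = {})"
  then have "J \<inter> I1 \<noteq> {}" "J \<inter> I2 \<noteq> {}" using I nonempty(1) [of J] by auto
  then have "(J \<union> I1) \<union> I2 \<in> \<B>" by (intro union J I) auto
  moreover have "(J \<union> I1) \<union> I2 = I1 \<union> I2" using J by auto
  ultimately show False using S by simp
qed

lemma block_in: "ext_nested X \<B> C \<Longrightarrow> Block J \<in> C \<Longrightarrow> J \<in> \<B>"
  using ext_nestedD(1) [of X \<B> C] by (auto simp: ext_vertices_def)

text \<open>By \<open>component\<close> such a family splits into a part inside \<open>I1\<close>
  and a part inside \<open>I2\<close>. Each part has a member of \<B> as its union, so nestedness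
  allows it only one set, namely the half itself.\<close>

lemma union_eq_imp:
  assumes C: "ext_nested X \<B> C" and F: "finite F" "\<And>J. J \<in> F \<Longrightarrow> Block J \<in> C"
    "pairwise disjnt F" "\<Union>F = I1 \<union> I2"
  shows "{Block I1, Block I2} \<subseteq> C"
proof -
  have FB: "J \<in> \<B>" if "J \<in> F" for J using block_in [OF C F(2) [OF that]] .
  have comp: "J \<subseteq> I1 \<and> J \<inter> I2 = {} \<or> J \<subseteq> I2 \<and> J \<inter> I1 = {}" if "J \<in> F" for J
    using component [OF FB [OF that]] that F(4) by blast
  have "Block L \<in> C" if L: "L = I1 \<or> L = I2" for L
  proof -
    define G where "G = {J \<in> F. J \<subseteq> L}"
    have "x \<in> \<Union>G" if "x \<in> L" for x
    proof -
      have "x \<in> \<Union>F" using F(4) L that by auto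
      then obtain J where J: "J \<in> F" "x \<in> J" by auto
      have "J \<subseteq> L" using L comp [OF J(1)] J(2) that I(3) by (elim disjE) auto
      then show ?thesis using J by (auto simp: G_def)
    qed
    then have "\<Union>G = L" by (auto simp: G_def)
    moreover have "L \<in> \<B>" using L I by auto
    ultimately have UG: "\<Union>G = L" "L \<in> \<B>" .
    then obtain J where J: "J \<in> G" using nonempty(1) [of L] by blast
    have "J' = J" if "J' \<in> G" for J'
    proof (rule ccontr)
      assume "J' \<noteq> J"
      then have "\<Union>G \<notin> \<B>"
        using C F J that
        by (intro ext_nested_union_notin [of X \<B> C G J' J])
           (auto simp: G_def intro: pairwise_mono)
      then show False using UG by simp
    qed
    then have "G = {J}" using J by blast
    then have "J = L" using UG(1) by simp
    then show ?thesis using J F(2) by (auto simp: G_def)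
  qed
  then show ?thesis by auto
qed

text \<open>Enlarging \<B> only forbids the disjoint families with union
  \<open>I1 \<union> I2\<close>, and by \<open>union_eq_imp\<close> a face has such a family exactly
  when it contains both halves.\<close>

lemma ext_nested_insert_iff1:
  assumes notin: "Block (I1 \<union> I2) \<notin> C"
  shows "ext_nested X (insert (I1 \<union> I2) \<B>) C \<longleftrightarrow>
    ext_nested X \<B> C \<and> \<not> {Block I1, Block I2} \<subseteq> C"
proof
  assume C: "ext_nested X (insert (I1 \<union> I2) \<B>) C"
  then have "ext_nested X \<B> C"
    using notin unfolding ext_nested_def ext_vertices_def by (auto simp: image_iff)
  moreover have "\<Union>{I1, I2} \<notin> insert (I1 \<union> I2) \<B>" if "{Block I1, Block I2} \<subseteq> C"
    using that I nonempty
    by (intro ext_nested_union_notin [OF C, of _ I1 I2]) (auto simp: pairwise_def disjnt_def)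
  ultimately show "ext_nested X \<B> C \<and> \<not> {Block I1, Block I2} \<subseteq> C" by auto
next
  assume C: "ext_nested X \<B> C \<and> \<not> {Block I1, Block I2} \<subseteq> C"
  have "\<Union>F \<noteq> I1 \<union> I2" if "F \<subseteq> {I. Block I \<in> C}" "card F \<ge> 2" "pairwise disjnt F" for F
  proof -
    have "finite F" using that(2) by (intro card_ge_0_finite) simp
    then show ?thesis using union_eq_imp [of C F] C that by auto
  qed
  moreover have "C \<subseteq> ext_vertices X (insert (I1 \<union> I2) \<B>)"
    using C ext_nestedD(1) [of X \<B> C] by (auto simp: ext_vertices_def)
  ultimately show "ext_nested X (insert (I1 \<union> I2) \<B>) C"
    using C unfolding ext_nested_def by simp
qed

text \<open>Both directions trade the new set for its two halves inside disjoint families: members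
  lying inside \<open>I1 \<union> I2\<close> are merged into the new set, or the new set is broken
  into \<open>I1\<close> and \<open>I2\<close>.\<close>

lemma ext_nested_insert_iff2:
  assumes notin: "Block (I1 \<union> I2) \<notin> C"
  shows "ext_nested X (insert (I1 \<union> I2) \<B>) (insert (Block (I1 \<union> I2)) C) \<longleftrightarrow>
    ext_nested X \<B> (insert (Block I1) (insert (Block I2) C)) \<and> \<not> {Block I1, Block I2} \<subseteq> C"
    (is "ext_nested X ?B' ?C' \<longleftrightarrow> ext_nested X \<B> ?D \<and> _")
proof
  let ?S = "I1 \<union> I2"
  assume C': "ext_nested X ?B' ?C'"
  have C: "ext_nested X \<B> C" "\<not> {Block I1, Block I2} \<subseteq> C"
    using ext_nested_insert_iff1 [OF assms] ext_nested_subset [OF C', of C] by auto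
  have nested: "J \<subseteq> I1 \<and> J \<inter> I2 = {} \<or> J \<subseteq> I2 \<and> J \<inter> I1 = {} \<or> ?S \<subseteq> J \<or> J \<inter> ?S = {}"
    if "Block J \<in> C" for J
  proof -
    have "J \<subseteq> ?S \<or> ?S \<subseteq> J \<or> disjnt J ?S"
      using ext_nestedD(2) [OF C' _ insertI1] that by simp
    then show ?thesis using component [OF block_in [OF C(1) that]] by (auto simp: disjnt_def)
  qed
  have "ext_nested X \<B> ?D"
    unfolding ext_nested_def
  proof (intro conjI allI impI)
    show "?D \<subseteq> ext_vertices X \<B>" using C(1) I by (auto simp: ext_nested_def ext_vertices_def)
  next
    fix J K assume "Block J \<in> ?D" "Block K \<in> ?D"
    then have JK: "J \<in> {I1, I2} \<or> Block J \<in> C" "K \<in> {I1, I2} \<or> Block K \<in> C" by auto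
    have sep: "J \<subseteq> L \<or> L \<subseteq> J \<or> disjnt J L" if "Block J \<in> C" "L \<in> {I1, I2}" for J L
      using nested [OF that(1)] that(2) by (elim disjE) (auto simp: disjnt_def)
    from JK show "J \<subseteq> K \<or> K \<subseteq> J \<or> disjnt J K"
    proof (elim disjE)
      assume "J \<in> {I1, I2}" "K \<in> {I1, I2}"
      then show ?thesis using I by (auto simp: disjnt_def)
    next
      assume "J \<in> {I1, I2}" "Block K \<in> C"
      then show ?thesis using sep [of K J] by (auto simp: disjnt_sym)
    next
      assume "Block J \<in> C" "K \<in> {I1, I2}"
      then show ?thesis by (rule sep)
    next
      assume "Block J \<in> C" "Block K \<in> C"
      then show ?thesis by (rule ext_nestedD(2) [OF C(1)])
    qed
  next
    fix i J assume "Sym i \<in> ?D" "Block J \<in> ?D"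
    then have "Sym i \<in> C" "J \<in> {I1, I2} \<or> Block J \<in> C" by auto
    moreover have "i \<notin> J" if "Sym i \<in> C" "Block J \<in> ?C'" for J
      using ext_nestedD(4) [OF C', of i J] that by simp
    note this [of J] this [of ?S]
    ultimately show "i \<notin> J" by auto
  next
    fix F assume F: "F \<subseteq> {I. Block I \<in> ?D}" "card F \<ge> 2" "pairwise disjnt F"
    have finF: "finite F" using F(2) by (intro card_ge_0_finite) simp
    show "\<Union>F \<notin> \<B>"
    proof (cases "I1 \<in> F \<or> I2 \<in> F")
      case False
      then have "F \<subseteq> {I. Block I \<in> C}" using F(1) by auto
      then show ?thesis using ext_nestedD(3) [OF C(1)] F(2,3) by simp
    next
      case True
      have disj: "J \<inter> K = {}" if "J \<in> F" "K \<in> F" "J \<noteq> K" for J K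
        using F(3) that by (auto simp: pairwise_def disjnt_def)
      have FB: "J \<in> \<B>" if "J \<in> F" for J using F(1) that block_in [OF C(1), of J] I by auto
      have cases: "J \<subseteq> ?S \<or> J \<inter> ?S = {}" if J: "J \<in> F" for J
      proof (cases "J = I1 \<or> J = I2")
        case False
        then have "Block J \<in> C" using F(1) J by auto
        moreover have "\<not> ?S \<subseteq> J"
        proof
          assume "?S \<subseteq> J"
          moreover obtain L where "L \<in> F" "L = I1 \<or> L = I2" using True by auto
          ultimately show False using disj [OF J, of L] False nonempty by auto
        qed
        ultimately show ?thesis using nested [of J] by auto
      qed auto
      \<comment> \<open>The members inside \<open>?S\<close> are replaced by \<open>?S\<close>
        itself. If some member lies outside, \<open>insert ?S G\<close> is an admissible family of
        at least two sets, but its union is \<open>\<Union>F \<union> ?S\<close>, a union of two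
        meeting members of \<open>?B'\<close>.\<close>
      define G where "G = {J \<in> F. J \<inter> ?S = {}}"
      show ?thesis
      proof
        assume U: "\<Union>F \<in> \<B>"
        show False
        proof (cases "G = {}")
          case True
          \<comment> \<open>With no member outside \<open>?S\<close>, the block
            \<open>\<Union>F\<close> lies in a single half. That half is already a member of
            \<open>F\<close>, so it is the only one.\<close>
          then have "\<Union>F \<subseteq> ?S" using cases by (auto simp: G_def)
          then have *: "\<Union>F \<subseteq> I1 \<and> \<Union>F \<inter> I2 = {} \<or> \<Union>F \<subseteq> I2 \<and> \<Union>F \<inter> I1 = {}"
            by (rule component [OF U])
          obtain L where L: "L \<in> F" "L = I1 \<or> L = I2" using \<open>I1 \<in> F \<or> I2 \<in> F\<close> by auto
          then have "\<Union>F \<subseteq> L" using * nonempty I by blast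
          then have "J = L" if "J \<in> F" for J
            using disj [OF that L(1)] nonempty(1) [OF FB [OF that]] that by blast
          then have "F = {L}" using L(1) by blast
          then show False using F(2) by simp
        next
          case False
          then obtain g where g: "g \<in> G" by auto
          have "g \<noteq> ?S" using g nonempty by (auto simp: G_def)
          have "Block J \<in> ?C'" if "J \<in> insert ?S G" for J
          proof (cases "J = ?S")
            case False
            then have "J \<in> F" "J \<inter> ?S = {}" using that by (auto simp: G_def)
            moreover from this have "J \<noteq> I1" "J \<noteq> I2" using nonempty by auto
            ultimately show ?thesis using F(1) by auto
          qed simp
          moreover have "pairwise disjnt (insert ?S G)"
            using disj by (auto simp: pairwise_def disjnt_def G_def)
          ultimately have "\<Union>(insert ?S G) \<notin> ?B'"
            using g finF \<open>g \<noteq> ?S\<close>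
            by (intro ext_nested_union_notin [OF C', of _ g ?S]) (auto simp: G_def)
          moreover have "J \<subseteq> ?S \<union> \<Union>G" if "J \<in> F" for J
            using cases [OF that] that by (auto simp: G_def)
          then have "\<Union>(insert ?S G) = \<Union>F \<union> ?S"
            unfolding Union_insert by (auto simp: G_def)
          moreover have "\<Union>F \<inter> ?S \<noteq> {}" using True nonempty by auto
          then have "\<Union>F \<union> ?S \<in> ?B'"
            using B' U by (simp add: building_set_def)
          ultimately show False by simp
        qed
      qed
    qed
  qed
  then show "ext_nested X \<B> ?D \<and> \<not> {Block I1, Block I2} \<subseteq> C" using C by simp
next
  let ?S = "I1 \<union> I2"
  assume *: "ext_nested X \<B> ?D \<and> \<not> {Block I1, Block I2} \<subseteq> C"
  then have D: "ext_nested X \<B> ?D" and C: "ext_nested X \<B> C" "\<not> {Block I1, Block I2} \<subseteq> C"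
    using ext_nested_subset [of X \<B> ?D C] by auto
  have nested: "J \<subseteq> ?S \<or> ?S \<subseteq> J \<or> J \<inter> ?S = {}" if J: "Block J \<in> C" for J
  proof (rule ccontr)
    assume n: "\<not> ?thesis"
    have JB: "J \<in> \<B>" by (rule block_in [OF C(1) J])
    have J1: "J \<subseteq> I1 \<or> I1 \<subseteq> J \<or> J \<inter> I1 = {}" and J2: "J \<subseteq> I2 \<or> I2 \<subseteq> J \<or> J \<inter> I2 = {}"
      using ext_nestedD(2) [OF D, of J] J by (auto simp: disjnt_def)
    \<comment> \<open>A block crossing \<open>?S\<close> but compatible with both halves contains
      one and misses the other, \<open>L\<close>. Then \<open>J\<close> and \<open>L\<close> are
      disjoint with union \<open>J \<union> ?S\<close>, which \<open>union'\<close> puts into \<B>,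
      against nestedness.\<close>
    have "I1 \<subseteq> J \<and> J \<inter> I2 = {} \<or> I2 \<subseteq> J \<and> J \<inter> I1 = {}"
      using n J1 J2 by (elim disjE) auto
    then obtain L where L: "L = I1 \<or> L = I2" "J \<inter> L = {}" "J \<union> L = J \<union> ?S"
    proof
      assume "I1 \<subseteq> J \<and> J \<inter> I2 = {}"
      then show thesis by (intro that [of I2]) auto
    next
      assume "I2 \<subseteq> J \<and> J \<inter> I1 = {}"
      then show thesis by (intro that [of I1]) auto
    qed
    have "J \<noteq> L" using L nonempty by auto
    then have "\<Union>{J, L} \<notin> \<B>"
      using L J by (intro ext_nested_union_notin [OF D, of _ J L]) (auto simp: pairwise_def disjnt_def)
    then show False using union' [OF JB] n L by auto
  qed
  show "ext_nested X ?B' ?C'"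
    unfolding ext_nested_def
  proof (intro conjI allI impI)
    show "?C' \<subseteq> ext_vertices X ?B'" using C(1) by (auto simp: ext_nested_def ext_vertices_def)
  next
    fix J K assume "Block J \<in> ?C'" "Block K \<in> ?C'"
    then have "J = ?S \<or> Block J \<in> C" "K = ?S \<or> Block K \<in> C" by auto
    then show "J \<subseteq> K \<or> K \<subseteq> J \<or> disjnt J K"
    proof (elim disjE)
      assume "J = ?S" "Block K \<in> C"
      then show ?thesis using nested [of K] unfolding disjnt_def by blast
    next
      assume "Block J \<in> C" "K = ?S"
      then show ?thesis using nested [of J] by (simp add: disjnt_def)
    next
      assume "Block J \<in> C" "Block K \<in> C"
      then show ?thesis by (rule ext_nestedD(2) [OF C(1)])
    qed simp
  next
    fix i J assume "Sym i \<in> ?C'" "Block J \<in> ?C'"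
    then have i: "Sym i \<in> C" and J: "J = ?S \<or> Block J \<in> C" by auto
    have "i \<notin> L" if "Block L \<in> ?D" for L
      using ext_nestedD(4) [OF D, of i L] i that by simp
    from this [of I1] this [of I2] this [of J] show "i \<notin> J" using J by auto
  next
    fix F assume F: "F \<subseteq> {I. Block I \<in> ?C'}" "card F \<ge> 2" "pairwise disjnt F"
    have finF: "finite F" using F(2) by (intro card_ge_0_finite) simp
    have disj: "J \<inter> K = {}" if "J \<in> F" "K \<in> F" "J \<noteq> K" for J K
      using F(3) that by (auto simp: pairwise_def disjnt_def)
    show "\<Union>F \<notin> ?B'"
    proof (cases "?S \<in> F")
      case False
      then have FC: "F \<subseteq> {I. Block I \<in> C}" using F(1) by auto
      then have "\<Union>F \<notin> \<B>" using ext_nestedD(3) [OF C(1)] F(2,3) by simp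
      moreover have "{Block I1, Block I2} \<subseteq> C" if "\<Union>F = ?S"
        using union_eq_imp [OF C(1) finF _ F(3) that] FC by auto
      then have "\<Union>F \<noteq> ?S" using C(2) by blast
      ultimately show ?thesis by simp
    next
      case True
      \<comment> \<open>Breaking \<open>?S\<close> into its halves keeps the family disjoint with
        the same union and places it in \<open>?D\<close>.\<close>
      define G where "G = F - {?S}"
      have "F \<noteq> {?S}" using F(2) by auto
      then obtain g where g: "g \<in> G" using True by (auto simp: G_def)
      have GC: "Block J \<in> C" "J \<inter> ?S = {}" "J \<in> \<B>" "J \<noteq> {}" if "J \<in> G" for J
      proof -
        show JC: "Block J \<in> C" using F(1) that by (auto simp: G_def)
        show "J \<inter> ?S = {}" using disj [OF _ True] that by (auto simp: G_def)
        show "J \<in> \<B>" by (rule block_in [OF C(1) JC])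
        then show "J \<noteq> {}" by (rule nonempty)
      qed
      have "pairwise disjnt (insert I1 (insert I2 G))"
        unfolding pairwise_insert
        using GC(2) I F(3) by (auto simp: disjnt_def G_def intro: pairwise_subset)
      moreover have "I1 \<noteq> I2" using I nonempty by auto
      ultimately have "\<Union>(insert I1 (insert I2 G)) \<notin> \<B>"
        using GC finF
        by (intro ext_nested_union_notin [OF D, of _ I1 I2]) (auto simp: G_def)
      moreover have "\<Union>(insert I1 (insert I2 G)) = \<Union>F" using True by (auto simp: G_def)
      moreover have "\<Union>F \<noteq> ?S" using g GC(2,4) [OF g] by (auto simp: G_def)
      ultimately show ?thesis by simp
    qed
  qed
qed

lemma ext_nested_complex_insert:
  assumes "finite X"
  shows "ext_nested_complex X (insert (I1 \<union> I2) \<B>) =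
    edge_subdivision (Block I1) (Block I2) (Block (I1 \<union> I2)) (ext_nested_complex X \<B>)"
    (is "?L = ?R")
proof (intro set_eqI)
  fix C
  have notin: "Block (I1 \<union> I2) \<notin> D" if "ext_nested X \<B> D" for D
    using that S block_in by blast
  show "C \<in> ?L \<longleftrightarrow> C \<in> ?R"
  proof (cases "Block (I1 \<union> I2) \<in> C")
    case False
    then show ?thesis
      using ext_nested_insert_iff1 [OF False]
      by (auto simp: ext_nested_complex_def edge_subdivision_def)
  next
    case True
    then obtain D where D: "C = insert (Block (I1 \<union> I2)) D" "Block (I1 \<union> I2) \<notin> D"
      by (meson mk_disjoint_insert)
    have "C \<in> ?R \<longleftrightarrow> ext_nested X \<B> (insert (Block I1) (insert (Block I2) D)) \<and>
        \<not> {Block I1, Block I2} \<subseteq> D"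
      (is "_ \<longleftrightarrow> ?N D")
    proof
      assume "C \<in> ?R"
      then obtain D' where D': "C = insert (Block (I1 \<union> I2)) D'" "?N D'"
        using notin True by (auto simp: ext_nested_complex_def edge_subdivision_def)
      then have "Block (I1 \<union> I2) \<notin> D'" using notin by blast
      then have "D' = D" using D D' by (metis insert_ident)
      then show "?N D" using D' by simp
    next
      assume "?N D"
      then show "C \<in> ?R" using D by (auto simp: ext_nested_complex_def edge_subdivision_def)
    qed
    then show ?thesis
      using ext_nested_insert_iff2 [OF D(2)] D(1) by (simp add: ext_nested_complex_def)
  qed
qed

lemma gamma_nonneg_links_insert:
  assumes "finite X" "gamma_nonneg_links (card X) (ext_nested_complex X \<B>)"
  shows "gamma_nonneg_links (card X) (ext_nested_complex X (insert (I1 \<union> I2) \<B>))"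
  unfolding ext_nested_complex_insert [OF assms(1)]
proof (rule gamma_nonneg_links_edge_subdivision)
  fix C assume "C \<in> ext_nested_complex X \<B>"
  then have C: "ext_nested X \<B> C" by (simp add: ext_nested_complex_def)
  show "finite C"
    using C finite_ext_vertices [OF assms(1) B] finite_subset by (auto simp: ext_nested_def)
  show "Block (I1 \<union> I2) \<notin> C" using block_in [OF C] S by blast
  show "D \<in> ext_nested_complex X \<B>" if "D \<subseteq> C" for D
    using ext_nested_subset [OF C that] by (simp add: ext_nested_complex_def)
qed (use assms B I nonempty in \<open>auto simp: finite_ext_nested_complex\<close>)

end

text \<open>Singletons are equal or disjoint, and a union of two or more is never a singleton. So
  the only constraint left is the one between the block {i} and the symbol x_i, which become
  opposite vertices.\<close>

lemma ext_nested_complex_singletons: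
  shows "ext_nested_complex X ((\<lambda>x. {x}) ` X) =
    {C. C \<subseteq> (\<lambda>x. Block {x}) ` X \<union> Sym ` X \<and> (\<forall>i\<in>X. \<not> {Block {i}, Sym i} \<subseteq> C)}"
    (is "?L = ?R")
proof (intro subset_antisym subsetI)
  fix C assume "C \<in> ?L"
  then show "C \<in> ?R"
    by (auto simp: ext_nested_complex_def ext_nested_def ext_vertices_def image_image)
next
  fix C assume C: "C \<in> ?R"
  then have blocks: "I \<in> (\<lambda>x. {x}) ` X" if "Block I \<in> C" for I using that by auto
  have "\<Union>F \<notin> (\<lambda>x. {x}) ` X" if F: "F \<subseteq> {I. Block I \<in> C}" "card F \<ge> 2" for F
  proof
    assume "\<Union>F \<in> (\<lambda>x. {x}) ` X"
    then obtain x where x: "\<Union>F = {x}" by auto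
    have "J = {x}" if "J \<in> F" for J
    proof -
      have "J \<noteq> {}" using blocks F(1) that by blast
      moreover have "J \<subseteq> {x}" using x that by blast
      ultimately show ?thesis by (simp add: subset_singleton_iff)
    qed
    then have "F \<subseteq> {{x}}" by auto
    then have "card F \<le> card {{x}}" by (intro card_mono) auto
    then show False using F(2) by simp
  qed
  moreover have "i \<notin> I" if "Sym i \<in> C" "Block I \<in> C" for i I
    using C that by auto
  moreover have "I \<subseteq> J \<or> J \<subseteq> I \<or> disjnt I J" if "Block I \<in> C" "Block J \<in> C" for I J
    using blocks [OF that(1)] blocks [OF that(2)] by (auto simp: disjnt_def)
  moreover have "C \<subseteq> ext_vertices X ((\<lambda>x. {x}) ` X)"
    using C by (auto simp: ext_vertices_def)
  ultimately show "C \<in> ?L" by (auto simp: ext_nested_complex_def ext_nested_def)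
qed

section \<open>Flagness and the order in which sets are added\<close>

definition decomposable :: "'a set set \<Rightarrow> bool" where
  "decomposable \<B> \<longleftrightarrow> (\<forall>I\<in>\<B>. (\<exists>x. I = {x}) \<or> (\<exists>J\<in>\<B>. \<exists>K\<in>\<B>. J \<inter> K = {} \<and> I = J \<union> K))"

lemma decomposable_if_flag:
  assumes fin: "finite X" and B: "building_set X \<B>"
    and flag: "flag_complex (ext_vertices X \<B>) (ext_nested_complex X \<B>)"
  shows "decomposable \<B>"
  unfolding decomposable_def
proof (intro ballI)
  fix I assume I: "I \<in> \<B>"
  then have IX: "I \<noteq> {}" "I \<subseteq> X" "finite I" using B fin finite_subset by (auto simp: building_set_def)
  \<comment> \<open>The bound 2 excludes the trivial partition {I}; the singletons provide a first
    partition.\<close>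
  define Q where "Q F \<longleftrightarrow> finite F \<and> F \<subseteq> \<B> \<and> pairwise disjnt F \<and> \<Union>F = I \<and> card F \<ge> 2" for F
  show "(\<exists>x. I = {x}) \<or> (\<exists>J\<in>\<B>. \<exists>K\<in>\<B>. J \<inter> K = {} \<and> I = J \<union> K)"
  proof (cases "\<exists>x. I = {x}")
    case False
    have "card ((\<lambda>x. {x}) ` I) = card I" by (rule card_image) simp
    moreover have "card I \<noteq> 0" "card I \<noteq> 1" using IX False by (auto simp: card_1_singleton_iff)
    then have "card I \<ge> 2" by linarith
    ultimately have "Q ((\<lambda>x. {x}) ` I)"
      using IX B by (auto simp: Q_def building_set_def pairwise_def disjnt_def)
    \<comment> \<open>In a minimal such partition with more than two parts no two parts can be merged, so
      flagness makes it a face, which is impossible because its union \<open>I\<close> lies in \<open>\<B>\<close>.\<close>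
    then obtain F where F: "Q F" and min: "\<And>G. Q G \<Longrightarrow> card F \<le> card G"
      using arg_min_natI [of Q _ card] arg_min_nat_le [of Q _ card] by metis
    have disj: "J \<inter> K = {}" if "J \<in> F" "K \<in> F" "J \<noteq> K" for J K
      using F that by (auto simp: Q_def pairwise_def disjnt_def)
    have pair: "J \<union> K \<notin> \<B>" if JK: "J \<in> F" "K \<in> F" "J \<noteq> K" "card F > 2" for J K
    proof
      assume JKB: "J \<union> K \<in> \<B>"
      let ?G = "insert (J \<union> K) (F - {J, K})"
      have "card (F - {J, K}) = card F - 2"
        using F JK by (subst card_Diff_subset) (auto simp: Q_def)
      moreover have "J \<union> K \<notin> F - {J, K}"
      proof
        assume *: "J \<union> K \<in> F - {J, K}"
        then have "(J \<union> K) \<inter> J = {}" "(J \<union> K) \<inter> K = {}" using disj JK by blast+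
        then have "J = K" by auto
        then show False using JK by simp
      qed
      ultimately have card: "card ?G = card F - 1" using F JK by (simp add: Q_def)
      have "J \<inter> L = {}" "K \<inter> L = {}" if "L \<in> F - {J, K}" for L
        using disj JK that by auto
      then have "pairwise disjnt ?G"
        using F by (auto simp: pairwise_insert disjnt_def Q_def intro: pairwise_subset)
      moreover have "\<Union>?G = I" using F JK by (auto simp: Q_def)
      ultimately have "Q ?G" using F JKB card JK by (auto simp: Q_def)
      then show False using min [of ?G] card JK by simp
    qed
    have "card F = 2"
    proof (rule ccontr)
      assume "card F \<noteq> 2"
      then have "card F > 2" using F by (simp add: Q_def)
      have "{u, w} \<in> ext_nested_complex X \<B>" if "u \<in> Block ` F" "w \<in> Block ` F" "u \<noteq> w" for u w
      proof -
        from that obtain J K where JK: "u = Block J" "w = Block K" "J \<in> F" "K \<in> F" "J \<noteq> K"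
          by auto
        have "\<Union>G \<notin> \<B>" if G: "G \<subseteq> {J, K}" "card G \<ge> 2" for G
        proof -
          have "G = {J, K}"
            using G JK by (intro card_seteq) auto
          then show ?thesis using pair [OF JK(3-5) \<open>card F > 2\<close>] by simp
        qed
        moreover have "{I. Block I \<in> {u, w}} = {J, K}" using JK by auto
        moreover have "{u, w} \<subseteq> ext_vertices X \<B>"
          using JK F by (auto simp: ext_vertices_def Q_def)
        moreover have "I \<subseteq> L \<or> L \<subseteq> I \<or> disjnt I L"
          if "Block I \<in> {u, w}" "Block L \<in> {u, w}" for I L
        proof -
          have "I \<in> {J, K}" "L \<in> {J, K}" using that JK(1,2) by auto
          then show ?thesis using disj [OF JK(3-5)] by (auto simp: disjnt_def)
        qed
        moreover have "Sym i \<notin> {u, w}" for i using JK(1,2) by simp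
        ultimately show ?thesis
          unfolding ext_nested_complex_def ext_nested_def mem_Collect_eq
          by (intro conjI allI impI) (simp_all only:, simp_all)
      qed
      moreover have "Block ` F \<subseteq> ext_vertices X \<B>" using F by (auto simp: ext_vertices_def Q_def)
      ultimately have "Block ` F \<in> ext_nested_complex X \<B>"
        using flag by (auto simp: flag_complex_def)
      moreover have "F \<subseteq> {I. Block I \<in> Block ` F}" by auto
      ultimately have "\<Union>F \<notin> \<B>"
        using ext_nestedD(3) [of X \<B> "Block ` F" F] F by (simp add: ext_nested_complex_def Q_def)
      then show False using F I by (simp add: Q_def)
    qed
    then obtain J K where JK: "F = {J, K}" "J \<noteq> K" by (auto simp: card_2_iff)
    then have "J \<inter> K = {}" "J \<in> \<B>" "K \<in> \<B>" "I = J \<union> K"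
      using F disj [of J K] by (auto simp: Q_def)
    then show ?thesis by blast
  qed simp
qed

text \<open>Take a largest building set \<A> inside \<B> that has the property. If sets are missing,
  the two pieces of a smallest one are smaller, hence in \<A>; so candidates for a subdivision step
  exist, and adding a largest candidate contradicts the choice of \<A>.\<close>

lemma gamma_nonneg_links_decomposable:
  assumes fin: "finite X" and B: "building_set X \<B>" and dec: "decomposable \<B>"
  shows "gamma_nonneg_links (card X) (ext_nested_complex X \<B>)"
proof -
  define Q where "Q \<A> \<longleftrightarrow> \<A> \<subseteq> \<B> \<and> building_set X \<A> \<and>
    gamma_nonneg_links (card X) (ext_nested_complex X \<A>)" for \<A>
  have finB: "finite \<B>" using B fin by (auto simp: building_set_def intro: finite_subset [of _ "Pow X"])
  have "building_set X ((\<lambda>x. {x}) ` X)" by (auto simp: building_set_def)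
  moreover have "gamma_nonneg_links (card X) (ext_nested_complex X ((\<lambda>x. {x}) ` X))"
    unfolding ext_nested_complex_singletons
    by (rule gamma_nonneg_links_cross_polytope [OF fin]) (auto simp: inj_on_def)
  ultimately have "Q ((\<lambda>x. {x}) ` X)" using B by (auto simp: Q_def building_set_def)
  moreover have "card \<A> \<le> card \<B>" if "Q \<A>" for \<A>
    using that finB by (auto simp: Q_def intro: card_mono)
  ultimately obtain \<A> where A: "Q \<A>" and maxA: "\<And>\<A>'. Q \<A>' \<Longrightarrow> card \<A>' \<le> card \<A>"
    using ex_has_greatest_nat [of Q "(\<lambda>x. {x}) ` X" card "Suc (card \<B>)"] by (auto simp: less_Suc_eq_le)
  have finA: "finite \<A>" using A finB by (auto simp: Q_def intro: finite_subset)
  have "\<A> = \<B>"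
  proof (rule ccontr)
    assume "\<A> \<noteq> \<B>"
    then have "\<exists>I. I \<in> \<B> - \<A>" using A by (auto simp: Q_def)
    then obtain I0 where I0: "I0 \<in> \<B> - \<A>" and minI0: "\<And>J. J \<in> \<B> - \<A> \<Longrightarrow> card I0 \<le> card J"
      using ex_has_least_nat [of "\<lambda>I. I \<in> \<B> - \<A>" _ card] by meson
    define R where "R I \<longleftrightarrow> I \<in> \<B> - \<A> \<and> (\<exists>J\<in>\<A>. \<exists>K\<in>\<A>. J \<inter> K = {} \<and> I = J \<union> K)" for I
    have "\<nexists>x. I0 = {x}" using I0 A B by (auto simp: Q_def building_set_def)
    then obtain J K where JK: "J \<in> \<B>" "K \<in> \<B>" "J \<inter> K = {}" "I0 = J \<union> K"
      using bspec [OF dec [unfolded decomposable_def], of I0] I0 by auto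
    have ne: "J \<noteq> {}" "K \<noteq> {}" and "I0 \<subseteq> X"
      using JK(1,2) B I0 by (auto simp: building_set_def)
    then have "finite I0" using fin finite_subset by auto
    then have "card J < card I0" "card K < card I0"
      using JK(3,4) ne by (auto intro!: psubset_card_mono)
    then have "J \<in> \<A>" "K \<in> \<A>" using minI0 [of J] minI0 [of K] JK(1,2) by auto
    then have "R I0" using JK(3,4) I0 unfolding R_def by blast
    moreover have "card I \<le> card X" if "R I" for I
      using that B fin by (auto simp: R_def building_set_def intro: card_mono)
    \<comment> \<open>Maximality of \<open>I\<close> is what makes \<open>insert I \<A>\<close> a building set: an \<open>L \<in> \<A>\<close> that
      meets only the half \<open>J\<close> would otherwise give the larger candidate \<open>(L \<union> J) \<union> K\<close>.\<close>
    ultimately obtain I where I: "R I" and maxI: "\<And>I'. R I' \<Longrightarrow> card I' \<le> card I"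
      using ex_has_greatest_nat [of R I0 card "Suc (card X)"] by (auto simp: less_Suc_eq_le)
    then obtain J K where JK: "J \<in> \<A>" "K \<in> \<A>" "J \<inter> K = {}" "I = J \<union> K" and IB: "I \<in> \<B>" "I \<notin> \<A>"
      by (auto simp: R_def)
    have U: "M \<union> N \<in> \<A>" if "M \<in> \<A>" "N \<in> \<A>" "M \<inter> N \<noteq> {}" for M N
      using A that by (auto simp: Q_def building_set_def)
    have half: "L \<union> (M \<union> N) \<in> insert (M \<union> N) \<A>"
      if MN: "M \<in> \<A>" "N \<in> \<A>" "M \<inter> N = {}" "I = M \<union> N" "L \<in> \<A>" "L \<inter> M \<noteq> {}" for L M N
    proof (cases "L \<inter> N = {}")
      case False
      have "L \<union> M \<in> \<A>" using U MN by blast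
      then have "(L \<union> M) \<union> N \<in> \<A>" using U [of "L \<union> M" N] MN False by blast
      then show ?thesis by (simp add: Un_assoc)
    next
      case True
      have LM: "L \<union> M \<in> \<A>" using U MN by blast
      have "L \<union> I \<in> \<A>" if L: "\<not> L \<subseteq> I"
      proof (rule ccontr)
        assume notin: "L \<union> I \<notin> \<A>"
        have "L \<in> \<B>" using A MN(5) by (auto simp: Q_def)
        moreover have "L \<inter> I \<noteq> {}" using MN(4,6) by auto
        ultimately have LI: "L \<union> I \<in> \<B>" using B IB(1) by (simp add: building_set_def)
        moreover have "(L \<union> M) \<inter> N = {}" "L \<union> I = (L \<union> M) \<union> N" using True MN(3,4) by auto
        ultimately have "R (L \<union> I)" unfolding R_def using notin LM MN(2) by blast
        then have "card (L \<union> I) \<le> card I" by (rule maxI)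
        moreover have "L \<union> I \<subseteq> X" using building_setD(2) [OF B LI] .
        then have "finite (L \<union> I)" using fin finite_subset by auto
        then have "card I < card (L \<union> I)" using L by (intro psubset_card_mono) auto
        ultimately show False by simp
      qed
      moreover have "L \<union> I = I" if "L \<subseteq> I" using that by auto
      ultimately show ?thesis unfolding MN(4) [symmetric] by auto
    qed
    have LI: "L \<union> I \<in> insert I \<A>" if L: "L \<in> \<A>" "L \<inter> I \<noteq> {}" for L
    proof (cases "L \<inter> J = {}")
      case True
      then have "L \<inter> K \<noteq> {}" using L JK(4) by auto
      then show ?thesis
        using half [of K J L] JK L by (simp add: Un_commute Int_commute)
    next
      case False
      then show ?thesis using half [of J K L] JK L by simp
    qed
    have "L \<union> M \<in> insert I \<A>"
      if "L \<in> insert I \<A>" "M \<in> insert I \<A>" "L \<inter> M \<noteq> {}" for L M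
    proof (cases "M = I")
      case True
      then show ?thesis using that LI [of L] by (cases "L = I") auto
    next
      case M: False
      show ?thesis
      proof (cases "L = I")
        case True
        then show ?thesis using that M LI [of M] by (simp add: Un_commute Int_commute)
      next
        case False
        then show ?thesis using that M U [of L M] by simp
      qed
    qed
    moreover have "L \<noteq> {} \<and> L \<subseteq> X" if "L \<in> insert I \<A>" for L
      using that A B IB(1) by (auto simp: Q_def building_set_def)
    moreover have "{x} \<in> insert I \<A>" if "x \<in> X" for x
      using that A by (simp add: Q_def building_set_def)
    ultimately have bs: "building_set X (insert I \<A>)"
      unfolding building_set_def by (intro conjI ballI impI) simp_all
    have "building_set X \<A>" using A by (simp add: Q_def)
    then interpret building_set_step X \<A> J K
      using bs JK(1-3) IB(2) unfolding JK(4) by (rule building_set_step.intro)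
    have "Q (insert I \<A>)"
      using gamma_nonneg_links_insert [OF fin] A bs JK IB by (auto simp: Q_def)
    then show False using maxA [of "insert I \<A>"] IB finA by simp
  qed
  then show ?thesis using A by (simp add: Q_def)
qed

section \<open>Polarity\<close>

text \<open>The conjugate face of polarity. The set \<open>A\<close> is a parameter because the map
  is used from \<open>Q\<close> to \<open>P\<close> and back; an empty \<open>F\<close> gives all of
  \<open>A\<close>.\<close>

definition dual_face :: "'v::euclidean_space set \<Rightarrow> 'v set \<Rightarrow> 'v set" where
  "dual_face A F = {y \<in> A. \<forall>x\<in>F. x \<bullet> y = 1}"

lemma face_of_dual_face:
  assumes "convex A" "\<And>x y. x \<in> F \<Longrightarrow> y \<in> A \<Longrightarrow> x \<bullet> y \<le> 1"
  shows "dual_face A F face_of A"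
proof (cases "F = {}")
  case True
  then show ?thesis using assms(1) by (simp add: dual_face_def face_of_refl)
next
  case False
  then have "dual_face A F = \<Inter>((\<lambda>x. A \<inter> {y. x \<bullet> y = 1}) ` F)"
    by (auto simp: dual_face_def)
  moreover have "\<dots> face_of A"
    using False assms by (intro face_of_Inter) (auto intro: face_of_Int_supporting_hyperplane_le)
  ultimately show ?thesis by simp
qed

text \<open>Separating and supporting hyperplanes come with normals in the ambient space; projecting
  orthogonally moves them into the span, where the polar lives.\<close>

lemma span_representer:
  fixes a :: "'v::euclidean_space"
  obtains a' where "a' \<in> span S" "\<And>x. x \<in> span S \<Longrightarrow> a' \<bullet> x = a \<bullet> x"
proof -
  obtain y z where yz: "y \<in> span S" "\<And>w. w \<in> span S \<Longrightarrow> orthogonal z w" "a = y + z"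
    using orthogonal_subspace_decomp_exists [of S a] by metis
  show thesis
    using yz by (intro that [of y]) (auto simp: inner_add_left orthogonal_def)
qed

locale polar_pair =
  fixes Q P :: "'v::euclidean_space set"
  assumes Q: "polytope Q" and zero: "0 \<in> rel_interior Q"
    and P_eq: "P = polar_dual Q" and P: "polytope P"
begin

lemma zero_Q: "0 \<in> Q"
  using zero rel_interior_subset by blast

lemma Q_span: "x \<in> Q \<Longrightarrow> x \<in> span Q"
  by (rule span_base)

lemma P_iff: "y \<in> P \<longleftrightarrow> y \<in> span Q \<and> (\<forall>x\<in>Q. x \<bullet> y \<le> 1)"
  by (simp add: P_eq polar_dual_def)

lemma zero_P: "0 \<in> P"
  by (simp add: P_iff span_zero)

lemma absorb:
  assumes "y \<in> span Q"
  shows "\<exists>c>0. c *\<^sub>R y \<in> P"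
proof -
  obtain M where M: "0 < M" "\<And>x. x \<in> Q \<Longrightarrow> norm x \<le> M"
    using polytope_imp_bounded [OF Q] bounded_pos by blast
  \<comment> \<open>The summand 1 keeps the denominator positive when \<open>y\<close> is 0.\<close>
  let ?c = "1 / (M * (norm y + 1))"
  have "x \<bullet> (?c *\<^sub>R y) \<le> 1" if "x \<in> Q" for x
  proof -
    have "x \<bullet> y \<le> norm x * norm y" by (rule norm_cauchy_schwarz)
    also have "\<dots> \<le> M * (norm y + 1)" using M that by (intro mult_mono) auto
    finally show ?thesis using M(1) by (simp add: field_simps add_pos_nonneg)
  qed
  moreover have "?c > 0" using M(1) by (simp add: add_nonneg_pos)
  ultimately show ?thesis using assms by (intro exI [of _ ?c]) (simp add: P_iff span_mul)
qed

lemma bipolar: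
  assumes "x \<in> span Q" "\<And>y. y \<in> P \<Longrightarrow> x \<bullet> y \<le> 1"
  shows "x \<in> Q"
proof (rule ccontr)
  assume "x \<notin> Q"
  then obtain a b where ab: "a \<bullet> x < b" "\<And>q. q \<in> Q \<Longrightarrow> a \<bullet> q > b"
    using separating_hyperplane_closed_point [of Q x] Q
    by (metis polytope_imp_closed polytope_imp_convex)
  \<comment> \<open>As \<open>b\<close> is negative, dividing by it reverses both inequalities: the
    rescaled normal lies in \<open>P\<close> but pairs with \<open>x\<close> to more than 1.\<close>
  then have b: "b < 0" using zero_Q by force
  obtain a' where a': "a' \<in> span Q" "\<And>x. x \<in> span Q \<Longrightarrow> a' \<bullet> x = a \<bullet> x"
    using span_representer by blast
  have "q \<bullet> (a' /\<^sub>R b) \<le> 1" if "q \<in> Q" for q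
    using ab(2) [OF that] a'(2) [OF Q_span [OF that]] b by (simp add: inner_commute field_simps)
  then have "a' /\<^sub>R b \<in> P" using a'(1) by (simp add: P_iff span_mul)
  then have "x \<bullet> (a' /\<^sub>R b) \<le> 1" by (rule assms(2))
  then show False
    using ab(1) a'(2) [OF assms(1)] b by (simp add: inner_commute field_simps)
qed

text \<open>Faces of polytopes are exposed. The origin is in the relative interior, hence off
  \<open>F\<close>, so the supporting value is positive and can be scaled to 1; the scaled normal is
  a point of the polar.\<close>

lemma proper_face_eq:
  assumes "F face_of Q" "F \<noteq> Q"
  obtains y where "y \<in> P" "F = {x \<in> Q. x \<bullet> y = 1}"
proof -
  have "F exposed_face_of Q"
    using assms(1) Q by (simp add: exposed_face_of_polyhedron polytope_imp_polyhedron)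
  then obtain a b where ab: "Q \<subseteq> {x. a \<bullet> x \<le> b}" "F = Q \<inter> {x. a \<bullet> x = b}"
    unfolding exposed_face_of_def by blast
  have "0 \<notin> F" using face_of_disjoint_rel_interior [OF assms] zero by auto
  then have b: "b > 0" using ab zero_Q by force
  obtain a' where a': "a' \<in> span Q" "\<And>x. x \<in> span Q \<Longrightarrow> a' \<bullet> x = a \<bullet> x"
    using span_representer by blast
  have eq: "x \<bullet> (a' /\<^sub>R b) = (a \<bullet> x) / b" if "x \<in> Q" for x
    using a'(2) [OF Q_span [OF that]] by (simp add: inner_commute field_simps)
  show thesis
  proof
    show "a' /\<^sub>R b \<in> P" using a'(1) ab(1) b eq by (auto simp: P_iff span_mul)
    show "F = {x \<in> Q. x \<bullet> (a' /\<^sub>R b) = 1}" using ab(2) b eq by auto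
  qed
qed

text \<open>The counterpart for \<open>P\<close>. A supporting value 0 would make the functional
  vanish on \<open>P\<close>, because \<open>absorb\<close> puts a positive multiple of each -y into
  \<open>P\<close>; then the face would be \<open>P\<close>. After scaling, \<open>bipolar\<close>
  places the normal in \<open>Q\<close>.\<close>

lemma nonempty_face_eq:
  assumes "G face_of P" "G \<noteq> {}" "G \<noteq> P"
  obtains x where "x \<in> Q" "G = {y \<in> P. x \<bullet> y = 1}"
proof -
  have "G exposed_face_of P"
    using assms(1) P by (simp add: exposed_face_of_polyhedron polytope_imp_polyhedron)
  then obtain a b where ab: "P \<subseteq> {x. a \<bullet> x \<le> b}" "G = P \<inter> {x. a \<bullet> x = b}"
    unfolding exposed_face_of_def by blast
  have "b \<ge> 0" using ab(1) zero_P by auto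
  moreover have "b \<noteq> 0"
  proof
    assume "b = 0"
    have "a \<bullet> y = 0" if y: "y \<in> P" for y
    proof -
      have "- y \<in> span Q" using y by (simp add: P_iff span_neg)
      then obtain c where "c > 0" "c *\<^sub>R (- y) \<in> P" using absorb by blast
      then have "a \<bullet> y \<ge> 0" using ab(1) \<open>b = 0\<close> by (auto simp: zero_le_mult_iff)
      moreover have "a \<bullet> y \<le> 0" using ab(1) \<open>b = 0\<close> y by auto
      ultimately show ?thesis by simp
    qed
    then have "G = P" using ab(2) \<open>b = 0\<close> by auto
    then show False using assms(3) by simp
  qed
  ultimately have b: "b > 0" by simp
  obtain a' where a': "a' \<in> span Q" "\<And>x. x \<in> span Q \<Longrightarrow> a' \<bullet> x = a \<bullet> x"
    using span_representer by blast
  have eq: "(a' /\<^sub>R b) \<bullet> y = (a \<bullet> y) / b" if "y \<in> P" for y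
    using a'(2) that by (simp add: P_iff field_simps)
  show thesis
  proof
    show "a' /\<^sub>R b \<in> Q"
    proof (rule bipolar)
      show "a' /\<^sub>R b \<in> span Q" using a'(1) by (rule span_mul)
      show "(a' /\<^sub>R b) \<bullet> y \<le> 1" if "y \<in> P" for y
        unfolding eq [OF that] using ab(1) b that by auto
    qed
    show "G = {y \<in> P. (a' /\<^sub>R b) \<bullet> y = 1}" using ab(2) b eq by auto
  qed
qed

text \<open>The double dual returns a face because the face is already cut out by a single point of
  the other polytope, which belongs to the dual face. The empty face of \<open>Q\<close> corresponds
  to \<open>P\<close> itself.\<close>

lemma dual_face_bij:
  "bij_betw (dual_face P) {F. F face_of Q \<and> F \<noteq> Q} {G. G face_of P \<and> G \<noteq> {}}"
proof (rule bij_betw_byWitness [where f' = "dual_face Q"])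
  show "\<forall>F\<in>{F. F face_of Q \<and> F \<noteq> Q}. dual_face Q (dual_face P F) = F"
  proof clarify
    fix F assume F: "F face_of Q" "F \<noteq> Q"
    then obtain y where y: "y \<in> P" "F = {x \<in> Q. x \<bullet> y = 1}" by (rule proper_face_eq)
    have "y \<in> dual_face P F" using y by (simp add: dual_face_def)
    then show "dual_face Q (dual_face P F) = F"
      using y(2) by (auto simp: dual_face_def inner_commute)
  qed
  show "\<forall>G\<in>{G. G face_of P \<and> G \<noteq> {}}. dual_face P (dual_face Q G) = G"
  proof clarify
    fix G assume G: "G face_of P" "G \<noteq> {}"
    show "dual_face P (dual_face Q G) = G"
    proof (cases "G = P")
      case True
      have "dual_face Q P = {}" using zero_P by (auto simp: dual_face_def intro!: bexI [of _ 0])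
      then have "dual_face P (dual_face Q P) = dual_face P {}" by (rule arg_cong)
      then show ?thesis unfolding True by (simp add: dual_face_def)
    next
      case False
      with G obtain x where x: "x \<in> Q" "G = {y \<in> P. x \<bullet> y = 1}" by (rule nonempty_face_eq)
      have "x \<in> dual_face Q G" using x by (simp add: dual_face_def inner_commute)
      then have "dual_face P (dual_face Q G) \<subseteq> {y \<in> P. x \<bullet> y = 1}"
        unfolding dual_face_def [of P] by blast
      then have "dual_face P (dual_face Q G) \<subseteq> G" using x(2) by simp
      moreover have "G \<subseteq> dual_face P (dual_face Q G)"
        using face_of_imp_subset [OF G(1)] unfolding dual_face_def by (auto simp: inner_commute)
      ultimately show ?thesis by (rule subset_antisym)
    qed
  qed
  show "dual_face P ` {F. F face_of Q \<and> F \<noteq> Q} \<subseteq> {G. G face_of P \<and> G \<noteq> {}}"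
  proof clarify
    fix F assume F: "F face_of Q" "F \<noteq> Q"
    then obtain y where y: "y \<in> P" "F = {x \<in> Q. x \<bullet> y = 1}" by (rule proper_face_eq)
    then have "y \<in> dual_face P F" by (simp add: dual_face_def)
    then have "dual_face P F \<noteq> {}" by blast
    moreover have "dual_face P F face_of P"
    proof (rule face_of_dual_face)
      show "convex P" using P by (rule polytope_imp_convex)
      show "x \<bullet> y \<le> 1" if "x \<in> F" "y \<in> P" for x y
        using face_of_imp_subset [OF F(1)] that by (auto simp: P_iff)
    qed
    ultimately show "dual_face P F face_of P \<and> dual_face P F \<noteq> {}" by simp
  qed
  show "dual_face Q ` {G. G face_of P \<and> G \<noteq> {}} \<subseteq> {F. F face_of Q \<and> F \<noteq> Q}"
  proof clarify
    fix G assume G: "G face_of P" "G \<noteq> {}"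
    then obtain y where "y \<in> G" by blast
    then have "0 \<notin> dual_face Q G" by (auto simp: dual_face_def)
    then have "dual_face Q G \<noteq> Q" using zero_Q by auto
    moreover have "dual_face Q G face_of Q"
    proof (rule face_of_dual_face)
      show "convex Q" using Q by (rule polytope_imp_convex)
      fix x y assume "x \<in> G" "y \<in> Q"
      then have "y \<bullet> x \<le> 1" using face_of_imp_subset [OF G(1)] by (auto simp: P_iff)
      then show "x \<bullet> y \<le> 1" by (simp only: inner_commute [of x y])
    qed
    ultimately show "dual_face Q G face_of Q \<and> dual_face Q G \<noteq> Q" by simp
  qed
qed

text \<open>The dual face spans the translate by \<open>y\<close> of \<open>W\<close>, the
  orthogonal complement of \<open>span F\<close> inside \<open>span Q\<close>. The extra 1 arises
  because \<open>span F\<close> is one dimension larger than the affine hull of \<open>F\<close>,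
  which misses the origin.\<close>

lemma aff_dim_dual_face:
  assumes F: "F face_of Q" "F \<noteq> Q"
  shows "aff_dim (dual_face P F) = aff_dim Q - 1 - aff_dim F"
proof -
  obtain y where y: "y \<in> P" "F = {x \<in> Q. x \<bullet> y = 1}" using F by (rule proper_face_eq)
  define W where "W = {z \<in> span Q. \<forall>x\<in>span F. orthogonal x z}"
  have W_iff: "z \<in> W \<longleftrightarrow> z \<in> span Q \<and> (\<forall>x\<in>F. x \<bullet> z = 0)" for z
    unfolding W_def using orthogonal_to_span [of _ F z]
    by (auto simp: orthogonal_def inner_commute span_base)
  have "F \<subseteq> Q" using y(2) by auto
  then have "dim W + dim (span F) = dim (span Q)"
    unfolding W_def by (intro dim_subspace_orthogonal_to_vectors) (auto simp: span_mono)
  moreover have "int (dim (span Q)) = aff_dim Q"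
    using zero_Q by (simp add: aff_dim_zero hull_inc)
  moreover have "int (dim (span F)) = aff_dim F + 1"
  proof -
    have "F \<subseteq> {x. y \<bullet> x = 1}" using y(2) by (auto simp: inner_commute)
    then have "affine hull F \<subseteq> {x. y \<bullet> x = 1}" by (intro hull_minimal affine_hyperplane)
    then have "0 \<notin> affine hull F" by auto
    then have "aff_dim (insert 0 F) = aff_dim F + 1" by (simp add: aff_dim_insert)
    moreover have "aff_dim (insert 0 F) = int (dim (insert 0 F))"
      by (intro aff_dim_zero) (simp add: hull_inc)
    ultimately show ?thesis by (simp add: dim_insert span_zero)
  qed
  moreover have "aff_dim (dual_face P F) = int (dim W)"
  proof (rule antisym)
    have subW: "subspace W"
      by (auto simp: subspace_def W_iff span_zero span_add span_mul inner_add_right)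
    then have dimW: "aff_dim ((+) y ` W) = int (dim W)"
      by (simp add: aff_dim_translation_eq aff_dim_subspace)
    have "dual_face P F \<subseteq> (+) y ` W"
    proof
      fix u assume u: "u \<in> dual_face P F"
      then have "u - y \<in> W"
        using y by (auto simp: W_iff dual_face_def P_iff inner_diff_right intro: span_diff)
      moreover have "u = y + (u - y)" by simp
      ultimately show "u \<in> (+) y ` W" by blast
    qed
    then show "aff_dim (dual_face P F) \<le> int (dim W)"
      using aff_dim_subset dimW by metis
    obtain S where S: "finite S" "Q = convex hull S" using Q by (auto simp: polytope_def)
    \<comment> \<open>Since \<open>y\<close> cuts out exactly \<open>F\<close>, the constraints from
      generators outside \<open>F\<close> are strict at \<open>y\<close>. They stay valid on this
      open set, so the dual face is full-dimensional in the translate of \<open>W\<close>.\<close>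
    define T where "T = (\<Inter>s\<in>S - F. {u. s \<bullet> u < 1})"
    have SQ: "s \<in> Q" if "s \<in> S" for s using that S by (simp add: hull_inc)
    have "open T" unfolding T_def using S(1) by (intro open_INT) (auto simp: open_halfspace_lt)
    moreover have "y \<in> T"
    proof -
      have "s \<bullet> y < 1" if "s \<in> S - F" for s
      proof -
        have "s \<bullet> y \<le> 1" using y(1) SQ that by (simp add: P_iff)
        moreover have "s \<bullet> y \<noteq> 1" using y(2) SQ that by auto
        ultimately show ?thesis by simp
      qed
      then show ?thesis by (simp add: T_def)
    qed
    moreover have "y \<in> (+) y ` W"
      using subspace_0 [OF subW] by (metis add.right_neutral image_eqI)
    moreover have "convex ((+) y ` W)"
      using subW by (intro convex_translation) (rule subspace_imp_convex)
    ultimately have "aff_dim ((+) y ` W \<inter> T) = aff_dim ((+) y ` W)"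
      by (intro aff_dim_convex_Int_open) auto
    moreover have "(+) y ` W \<inter> T \<subseteq> dual_face P F"
    proof
      fix u assume "u \<in> (+) y ` W \<inter> T"
      then obtain z where z: "z \<in> W" "u = y + z" "u \<in> T" by auto
      have on_F: "x \<bullet> u = 1" if "x \<in> F" for x
        using z y that by (auto simp: W_iff inner_add_right)
      have "s \<bullet> u \<le> 1" if "s \<in> S" for s
        using on_F [of s] z(3) that by (cases "s \<in> F") (auto simp: T_def less_imp_le)
      then have "convex hull S \<subseteq> {x. u \<bullet> x \<le> 1}"
        by (intro hull_minimal convex_halfspace_le) (auto simp: inner_commute)
      then have "\<forall>x\<in>Q. x \<bullet> u \<le> 1" using S(2) by (auto simp: inner_commute)
      moreover have "u \<in> span Q" using z y(1) by (simp add: W_iff P_iff span_add)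
      ultimately show "u \<in> dual_face P F" using on_F by (simp add: dual_face_def P_iff)
    qed
    ultimately show "int (dim W) \<le> aff_dim (dual_face P F)"
      using aff_dim_subset dimW by metis
  qed
  ultimately show ?thesis by linarith
qed

text \<open>The empty face has affine dimension -1, and its dual face is \<open>P\<close>.\<close>

lemma aff_dim_P: "aff_dim P = aff_dim Q"
proof -
  have "{} \<noteq> Q" using zero_Q by auto
  then show ?thesis using aff_dim_dual_face [of "{}"] by (simp add: dual_face_def)
qed

end

section \<open>Face numbers of the nestohedron from the complex\<close>

lemma aff_dim_boundary_face:
  fixes v :: "'b \<Rightarrow> 'v::euclidean_space"
  assumes inj: "inj_on v V" and "C \<subseteq> V" "finite C"
    and hull_inj: "inj_on (\<lambda>C. convex hull (v ` C)) K" and C: "C \<in> K"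
    and down: "\<And>D. D \<subseteq> C \<Longrightarrow> D \<in> K"
    and simplex: "n simplex (convex hull (v ` C))"
  shows "aff_dim (convex hull (v ` C)) = int (card C) - 1"
proof -
  obtain A where A: "\<not> affine_dependent A" "convex hull (v ` C) = convex hull A"
    using simplex unfolding simplex_def by auto
  have "{x. x extreme_point_of (convex hull (v ` C))} = v ` C"
  proof (rule extreme_points_of_convex_hull_eq)
    show "compact (v ` C)" using \<open>finite C\<close> by (simp add: finite_imp_compact)
    fix T assume T: "T \<subset> v ` C"
    define D where "D = {c \<in> C. v c \<in> T}"
    have "T = v ` D" "D \<subseteq> C" using T by (auto simp: D_def)
    moreover have "D \<noteq> C" using T calculation by auto
    ultimately show "convex hull T \<noteq> convex hull (v ` C)"
      using inj_onD [OF hull_inj _ down C, of D] by auto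
  qed
  moreover have "{x. x extreme_point_of (convex hull (v ` C))} = A"
    unfolding A(2) using extreme_point_of_convex_hull_affine_independent [OF A(1)] by auto
  ultimately have "v ` C = A" by simp
  then show ?thesis
    using aff_dim_affine_independent [OF A(1)] card_image [OF inj_on_subset [OF inj \<open>C \<subseteq> V\<close>]]
    by (simp add: aff_dim_convex_hull)
qed

text \<open>A face C of the complex corresponds to a face of \<open>P\<close> of dimension d - |C|,
  and h(t) = f(t - 1) turns its monomial into the power of t - 1 that appears in
  \<open>star_poly\<close>.\<close>

lemma h_poly_eq_star_poly:
  fixes P :: "'v::euclidean_space set"
  assumes fin: "finite X" and B: "building_set X \<B>"
    and P: "extended_nestohedron X \<B> P" "polytope P"
    and card_le: "\<And>C. C \<in> ext_nested_complex X \<B> \<Longrightarrow> card C \<le> card X"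
  shows "poly_dim P = card X" "h_poly P = star_poly (card X) (ext_nested_complex X \<B>) {}"
proof -
  let ?K = "ext_nested_complex X \<B>" and ?V = "ext_vertices X \<B>"
  obtain Q v where simplicial: "simplicial_polytope Q" and dim_Q: "aff_dim Q = int (card X)"
    and zero: "0 \<in> rel_interior Q"
    and PQ: "P = polar_dual Q" and v: "inj_on v ?V"
    and bij: "bij_betw (\<lambda>C. convex hull (v ` C)) ?K {F. F face_of Q \<and> F \<noteq> Q}"
    using P(1) unfolding extended_nestohedron_def has_boundary_complex_def by blast
  interpret polar_pair Q P
    using simplicial zero PQ P(2) by unfold_locales (auto simp: simplicial_polytope_def)
  show dim: "poly_dim P = card X" by (simp add: poly_dim_def aff_dim_P dim_Q)
  have fV: "finite ?V" by (rule finite_ext_vertices [OF fin B])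
  have finK: "finite ?K" by (rule finite_ext_nested_complex [OF fin B])
  let ?\<phi> = "\<lambda>C. dual_face P (convex hull (v ` C))"
  have face: "(convex hull (v ` C)) face_of Q" "convex hull (v ` C) \<noteq> Q" if "C \<in> ?K" for C
    using bij that by (auto simp: bij_betw_def)
  have aff_dim_\<phi>: "aff_dim (?\<phi> C) = int (card X - card C)" if C: "C \<in> ?K" for C
  proof -
    have N: "ext_nested X \<B> C" using C by (simp add: ext_nested_complex_def)
    obtain n where "n simplex (convex hull (v ` C))"
      using simplicial face [OF C] by (auto simp: simplicial_polytope_def)
    then have "aff_dim (convex hull (v ` C)) = int (card C) - 1"
      using v ext_nestedD(1) [OF N] finite_subset [OF ext_nestedD(1) [OF N] fV]
        bij_betw_imp_inj_on [OF bij] C ext_nested_subset [OF N]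
      by (intro aff_dim_boundary_face) (auto simp: ext_nested_complex_def)
    then show ?thesis
      using aff_dim_dual_face [OF face [OF C]] dim_Q card_le [OF C] by simp
  qed
  have bij_\<phi>: "bij_betw ?\<phi> ?K {G. G face_of P \<and> G \<noteq> {}}"
    using bij_betw_trans [OF bij dual_face_bij] by (simp add: o_def)
  have num: "num_faces P i = card {C \<in> ?K. card X - card C = i}" for i
  proof -
    have "?\<phi> ` {C \<in> ?K. card X - card C = i} = {G. G face_of P \<and> aff_dim G = int i}"
    proof (intro subset_antisym subsetI)
      fix G assume "G \<in> ?\<phi> ` {C \<in> ?K. card X - card C = i}"
      then show "G \<in> {G. G face_of P \<and> aff_dim G = int i}"
        using aff_dim_\<phi> bij_betw_apply [OF bij_\<phi>] by auto
    next
      fix G assume G: "G \<in> {G. G face_of P \<and> aff_dim G = int i}"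
      then have "G \<noteq> {}" by auto
      then have "G \<in> ?\<phi> ` ?K" using G bij_\<phi> by (auto simp: bij_betw_def)
      then show "G \<in> ?\<phi> ` {C \<in> ?K. card X - card C = i}"
        using G aff_dim_\<phi> by auto
    qed
    moreover have "inj_on ?\<phi> {C \<in> ?K. card X - card C = i}"
      by (rule inj_on_subset [OF bij_betw_imp_inj_on [OF bij_\<phi>]]) auto
    from card_image [OF this] calculation show ?thesis by (simp only: num_faces_def)
  qed
  have "f_poly P = (\<Sum>i\<le>card X. \<Sum>C | C \<in> ?K \<and> card X - card C = i. monom 1 (card X - card C))"
    unfolding f_poly_def dim num
  proof (intro sum.cong refl)
    fix i
    let ?S = "{C \<in> ?K. card X - card C = i}"
    have "(\<Sum>C\<in>?S. monom (1::int) (card X - card C)) = (\<Sum>C\<in>?S. monom 1 i)"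
      by (intro sum.cong) auto
    also have "\<dots> = monom (int (card ?S)) i"
      by (simp add: of_nat_poly smult_monom)
    finally show "monom (int (card ?S)) i = (\<Sum>C\<in>?S. monom 1 (card X - card C))" by simp
  qed
  also have "\<dots> = (\<Sum>C\<in>?K. monom 1 (card X - card C))"
    using finK by (intro sum.group) auto
  finally have "h_poly P = (\<Sum>C\<in>?K. pcompose (monom 1 (card X - card C)) [:-1, 1:])"
    by (simp add: h_poly_def pcompose_sum)
  moreover have "pcompose (monom 1 n) [:-1, 1:] = ([:-1, 1:] :: int poly) ^ n" for n
    by (induction n) (simp_all add: monom_Suc pcompose_pCons pcompose_1)
  ultimately show "h_poly P = star_poly (card X) ?K {}"
    by (simp add: star_poly_def)
qed

theorem theorem5p18:
  fixes X :: "'a set" and \<B> :: "'a set set" and P :: "'v::euclidean_space set"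
  assumes "finite X"
    and "building_set X \<B>"
    and "extended_nestohedron X \<B> P"
    and "simple_polytope P"
    and "flag_complex (ext_vertices X \<B>) (ext_nested_complex X \<B>)"
  shows "\<forall>c\<in>set (gamma_vector P). 0 \<le> c"
proof -
  have good: "gamma_nonneg_links (card X) (ext_nested_complex X \<B>)"
    using assms by (intro gamma_nonneg_links_decomposable decomposable_if_flag)
  have "polytope P" using assms(4) by (simp add: simple_polytope_def)
  moreover have "card C \<le> card X" if "C \<in> ext_nested_complex X \<B>" for C
    using good that by (simp add: gamma_nonneg_links_def)
  ultimately have h: "poly_dim P = card X"
    "h_poly P = star_poly (card X) (ext_nested_complex X \<B>) {}"
    using h_poly_eq_star_poly [OF assms(1-3)] by blast+
  \<comment> \<open>The link of the empty face is the whole complex.\<close>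
  have "{} \<in> ext_nested_complex X \<B>" by (simp add: ext_nested_complex_def ext_nested_def)
  then have "h_poly P \<in> gamma_nonneg (card X)"
    using good by (auto simp: h(2) gamma_nonneg_links_def)
  then obtain g where g: "\<forall>i. 0 \<le> g i"
    and "h_poly P = (\<Sum>i\<le>card X div 2. smult (g i) ([:0, 1:] ^ i * [:1, 1:] ^ (card X - 2 * i)))"
    unfolding gamma_nonneg_def by blast
  then have "is_gamma_vector P (map g [0..<card X div 2 + 1])"
    unfolding is_gamma_vector_def gamma_expansion_def h(1)
    by (auto intro!: sum.cong simp del: upt_Suc)
  from gamma_vector_eqI [OF this] show ?thesis using g by auto
qed

end
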